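(* Let $X$ be a separated locally convex topological vector space. Let $m\in\mathbb{N}$, and let $f_i:X\to\left]-\infty,+\infty\right]$ be proper and sublinear for each $i\in\{1,2,\ldots,m\}$. Suppose that, for every $i\in\{1,\ldots,m\}$, $\overline{f_i}=f_i$ on $\bigcap_{j=1}^{m}\operatorname{dom}\overline{f_j}$. Then the following eight conditions are equivalent. (i) There exists $K>0$ such that for every $x\in \bigcap_{i=1}^{m}\operatorname{dom} f_i$ and every $\varepsilon>0$, $$\overline{\left[\sum_{i=1}^{m}\partial_\varepsilon f_i(x)\right]}^{\mathrm{w*}}\subseteq\sum_{i=1}^{m}\partial_{K\varepsilon} f_i(x).$$ (ii) $\sum_{i=1}^m\partial f_i(0)$ is weak$^*$ closed. (iii) $\left(\sum_{i=1}^m f_i\right)^*=f_1^*\Box\cdots \Box f_m^*$ in $X^*$. (iv) $f_1^*\Box\cdots \Box f_m^*$ is weak$^*$ lower semicontinuous. (v) For every $x\in X$ and every $\varepsilon\geq0$, $$\partial_{\varepsilon}(f_1+\cdots+f_m)(x)= \bigcap_{\eta>0} \left[ \bigcup_{\varepsilon_i\geq0,\ \sum_{i=1}^m\varepsilon_i=\varepsilon+\eta}\Big(\partial_{\varepsilon_1} f_1(x)+\cdots+\partial_{\varepsilon_m} f_m(x)\Big)\right].$$ (vi) $\operatorname{epi} f^*_1+\cdots+\operatorname{epi} f^*_m$ is closed in the topology $\omega (X^*, X)\times \mathbb{R}$. (vii) $\left(\sum_{i=1}^m f_i\right)^*=f_1^*\Box\cdots \Box f_m^*$ in $X^*$ and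 the infimal convolution is exact (attained) everywhere it is finite. (viii) $\partial (f_1+f_2+\cdots+f_m)=\partial f_1+\cdots+\partial f_m$.
   Context: $X$ is a separated (Hausdorff) locally convex topological vector space and $X^*$ is its continuous dual endowed with the weak$^*$ topology $\omega(X^*,X)$; $\overline{D}^{\mathrm{w*}}$ is the weak$^*$ closure of $D\subseteq X^*$. The topology $\omega(X^*,X)\times\mathbb{R}$ on $X^*\times\mathbb{R}$ is the product of the weak$^*$ topology and the usual topology of $\mathbb{R}$. Sums of sets are Minkowski sums. A function $f:X\to\left]-\infty,+\infty\right]$ is sublinear if $f(x+y)\le f(x)+f(y)$, $f(0)=0$, and $f(tx)=tf(x)$ for every $x,y\in\operatorname{dom} f$ and $t\ge0$. For $f:X\to[-\infty,+\infty]$: $\operatorname{dom} f=\{x: f(x)<+\infty\}$; $f$ is proper if $\operatorname{dom} f\neq\varnothing$ and $f>-\infty$ everywhere; $\overline{f}$ is the lower semicontinuous hull of $f$; the Fenchel conjugate is $f^*:X^*\to[-\infty,+\infty]$, $f^*(x^* )=\sup_{x\in X}\{\langle x,x^*\rangle-f(x)\}$; the epigraph of a function $h$ is the set of pairs $(z,r)$ with $r\in\mathbb{R}$ and $h(z)\le r$. For $\varepsilon\ge0$, $\partial_\varepsilon f(x)=\{x^*\in X^*: \langle y-x,x^*\rangle+f(x)\le f(y)+\varepsilon\ \ \forall y\in X\}$ if $f(x)\in\mathbb{R}$, and $\partial_\varepsilon f(x)=\varnothing$ otherwise; $\partial f=\partial_0 f$. Equality of subdifferentials means equality at every point of $X$,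 the right-hand side being the pointwise Minkowski sum. The infimal convolution is $(f_1^*\Box\cdots\Box f_m^* )(z^* )=\inf\{f_1^*(z_1^* )+\cdots+f_m^*(z_m^* ): z_1^*+\cdots+z_m^*=z^*\}$; it is exact at $z^*$ if this infimum is attained. *)

theory Defs
  imports "HOL-Analysis.Analysis"
begin

section \<open>Separated locally convex spaces\<close>

class locally_convex_space = real_vector + topological_ab_group_add + t2_space +
  assumes tendsto_scaleR_Pair: "LIM p (nhds c \<times>\<^sub>F nhds x). fst p *\<^sub>R snd p :> nhds (c *\<^sub>R x)"
    and locally_convex:
      "open U \<Longrightarrow> 0 \<in> U \<Longrightarrow>
        \<exists>V. open V \<and> 0 \<in> V \<and> V \<subseteq> U \<and>
          (\<forall>x\<in>V. \<forall>y\<in>V. \<forall>u\<ge>0. \<forall>v\<ge>0. u + v = 1 \<longrightarrow> u *\<^sub>R x + v *\<^sub>R y \<in> V)"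

lemma locally_convex_nhd_basis:
  fixes U :: "'a::locally_convex_space set"
  assumes "open U" "0 \<in> U"
  obtains V where "open V" "convex V" "0 \<in> V" "V \<subseteq> U"
  using locally_convex[OF assms] unfolding convex_def by blast

instance real_normed_vector \<subseteq> locally_convex_space
proof
  fix c :: real and x :: 'a
  show "LIM p (nhds c \<times>\<^sub>F nhds x). fst p *\<^sub>R snd p :> nhds (c *\<^sub>R x)"
    unfolding nhds_prod[symmetric]
    using tendsto_scaleR[OF tendsto_fst[OF filterlim_ident] tendsto_snd[OF filterlim_ident],
        of "(c, x)"] by simp
next
  fix U :: "'a set"
  assume "open U" "0 \<in> U"
  then obtain e where e: "e > 0" "ball 0 e \<subseteq> U"
    by (auto simp: open_contains_ball)
  have "convex (ball (0::'a) e)" by (rule convex_ball)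
  with e show "\<exists>V. open V \<and> 0 \<in> V \<and> V \<subseteq> U \<and>
      (\<forall>x\<in>V. \<forall>y\<in>V. \<forall>u\<ge>0. \<forall>v\<ge>0. u + v = 1 \<longrightarrow> u *\<^sub>R x + v *\<^sub>R y \<in> V)"
    unfolding convex_def by (intro exI[of _ "ball 0 e"]) auto
qed

section \<open>The continuous dual with the weak-star topology\<close>

typedef (overloaded) 'a dual =
  "{\<phi> :: 'a::locally_convex_space \<Rightarrow> real. linear \<phi> \<and> continuous_on UNIV \<phi>}"
  morphisms dual_apply Dual
  by (rule exI[of _ "\<lambda>_. 0"]) (simp add: linear_zero)

setup_lifting type_definition_dual

instantiation dual :: (locally_convex_space) real_vector
begin

lift_definition zero_dual :: "'a dual" is "\<lambda>_. 0"
  by (simp add: linear_zero)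

lift_definition plus_dual :: "'a dual \<Rightarrow> 'a dual \<Rightarrow> 'a dual" is "\<lambda>\<phi> \<psi> x. \<phi> x + \<psi> x"
  by (auto intro: linear_compose_add continuous_on_add)

lift_definition uminus_dual :: "'a dual \<Rightarrow> 'a dual" is "\<lambda>\<phi> x. - \<phi> x"
  by (auto intro: linear_compose_neg continuous_on_minus)

lift_definition minus_dual :: "'a dual \<Rightarrow> 'a dual \<Rightarrow> 'a dual" is "\<lambda>\<phi> \<psi> x. \<phi> x - \<psi> x"
  by (auto intro: linear_compose_sub continuous_on_diff)

lift_definition scaleR_dual :: "real \<Rightarrow> 'a dual \<Rightarrow> 'a dual" is "\<lambda>c \<phi> x. c * \<phi> x"
  using linear_compose_scale_right by (force intro: continuous_on_mult_left)

instance
  by standard (transfer; auto simp: algebra_simps)+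

end

instantiation dual :: (locally_convex_space) topological_space
begin

text \<open>The coarsest topology that makes every evaluation \<open>\<phi> \<mapsto> \<phi> x\<close> continuous.\<close>

definition open_dual :: "'a dual set \<Rightarrow> bool" where
  "open_dual = generate_topology {{\<phi>. dual_apply \<phi> x \<in> S} | x S. open S}"

instance
  by standard (auto simp: open_dual_def intro: generate_topology.intros)

end

section \<open>Convex analysis with extended-real-valued functions\<close>

definition edom :: "('a \<Rightarrow> ereal) \<Rightarrow> 'a set" where
  "edom f = {x. f x < \<infinity>}"

definition proper :: "('a \<Rightarrow> ereal) \<Rightarrow> bool" where
  "proper f \<longleftrightarrow> edom f \<noteq> {} \<and> (\<forall>x. f x > -\<infinity>)"

definition sublinear :: "('a::real_vector \<Rightarrow> ereal) \<Rightarrow> bool" where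
  "sublinear f \<longleftrightarrow> f 0 = 0 \<and>
    (\<forall>x\<in>edom f. \<forall>y\<in>edom f. f (x + y) \<le> f x + f y) \<and>
    (\<forall>x\<in>edom f. \<forall>t\<ge>0. f (t *\<^sub>R x) = ereal t * f x)"

definition lower_semicontinuous :: "('a::topological_space \<Rightarrow> ereal) \<Rightarrow> bool" where
  "lower_semicontinuous f \<longleftrightarrow> (\<forall>x. \<forall>a < f x. \<forall>\<^sub>F y in nhds x. a < f y)"

definition lsc_hull :: "('a::topological_space \<Rightarrow> ereal) \<Rightarrow> 'a \<Rightarrow> ereal" where
  "lsc_hull f x = (SUP g \<in> {g. lower_semicontinuous g \<and> g \<le> f}. g x)"

definition conjugate :: "('a::locally_convex_space \<Rightarrow> ereal) \<Rightarrow> 'a dual \<Rightarrow> ereal" where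
  "conjugate f \<phi> = (SUP x. ereal (dual_apply \<phi> x) - f x)"

definition epi :: "('a \<Rightarrow> ereal) \<Rightarrow> ('a \<times> real) set" where
  "epi h = {(z, r). h z \<le> ereal r}"

definition eps_subdiff ::
    "real \<Rightarrow> ('a::locally_convex_space \<Rightarrow> ereal) \<Rightarrow> 'a \<Rightarrow> 'a dual set" where
  "eps_subdiff \<epsilon> f x =
    (if \<bar>f x\<bar> \<noteq> \<infinity>
     then {\<phi>. \<forall>y. ereal (dual_apply \<phi> (y - x)) + f x \<le> f y + ereal \<epsilon>}
     else {})"

abbreviation subdiff :: "('a::locally_convex_space \<Rightarrow> ereal) \<Rightarrow> 'a \<Rightarrow> 'a dual set" where
  "subdiff \<equiv> eps_subdiff 0"

text \<open>
  The infimal convolution of the finite family \<open>h i\<close>, \<open>i \<in> I\<close>. Addition on \<^typ>\<open>ereal\<close> satisfies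
  \<open>\<infinity> + (-\<infinity>) = \<infinity>\<close>; this case does not arise below, as conjugates of proper functions
  never take the value \<open>-\<infinity>\<close>.
\<close>

definition inf_conv :: "'i set \<Rightarrow> ('i \<Rightarrow> 'b::comm_monoid_add \<Rightarrow> ereal) \<Rightarrow> 'b \<Rightarrow> ereal" where
  "inf_conv I h z = Inf {\<Sum>i\<in>I. h i (w i) | w. (\<Sum>i\<in>I. w i) = z}"

definition inf_conv_exact_at ::
    "'i set \<Rightarrow> ('i \<Rightarrow> 'b::comm_monoid_add \<Rightarrow> ereal) \<Rightarrow> 'b \<Rightarrow> bool" where
  "inf_conv_exact_at I h z \<longleftrightarrow>
    (\<exists>w. (\<Sum>i\<in>I. w i) = z \<and> (\<Sum>i\<in>I. h i (w i)) = inf_conv I h z)"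

definition all_equivalent :: "bool list \<Rightarrow> bool" where
  "all_equivalent Ps \<longleftrightarrow> (\<forall>P\<in>set Ps. \<forall>Q\<in>set Ps. P \<longleftrightarrow> Q)"

text \<open>
  Sums of sets, such as \<open>\<Sum>i\<in>I. A i\<close> with sets \<open>A i\<close>, are Minkowski sums
  (\<^theory>\<open>HOL-Library.Set_Algebras\<close>). Topological notions on \<^typ>\<open>'a dual\<close> refer to the weak-star
  topology, and those on \<^typ>\<open>'a dual \<times> real\<close> to its product with the usual topology of the reals.
\<close>

end

(*
  Let A i = subdiff (f i) 0, let F be the sum of the f i and A = subdiff F 0. Sublinearity makes each
  conjugate the indicator function of A i, makes the infimal convolution the indicator of the
  Minkowski sum S of the A i, and turns eps_subdiff e (f i) x into {phi in A i. f i x <= phi x + e}.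
  Hence each of the eight conditions says either that S is weak-star closed or that A = S. Since A is
  weak-star closed and contains S, these two agree as soon as A is contained in the closure of S. If
  some phi in A were not in that closure, Hahn-Banach would give a point x with phi x strictly above
  the sum of the support functions of the A i at x. These support functions dominate the lower
  semicontinuous hulls of the f i, so x lies in the domain of every hull, where hulls and functions
  agree, and phi x > F x contradicts phi in A.
*)

theory Submission
  imports Defs
begin

section \<open>Algebraic Hahn-Banach separation\<close>

text \<open>The hull hypothesis is applied at two points. At the origin each hull is at most 0, so 0
  lies in every hull domain and each hull equals 0 there. Excluding the value
  \<open>-\<infinity>\<close> at 0 is what makes every \<open>subdiff (f i) 0\<close> nonempty and
  puts each hull below its support function. Only then can the hypothesis be applied at the
  separating point, whose membership in the hull domains has to be read off a bound on the whole
  sum. Conditions that quantify over points are tested at the origin, where slack is invisible to a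
  sublinear function. The way back to a general point is to redistribute slack: a decomposition of a
  functional in S leaves one nonnegative gap per index, and only the sum of the gaps is constrained.
  Separation is needed both in X times the reals and in the dual. Both cases come from one algebraic
  statement about absorbing sets; the bound on the absorbing set then yields continuity of the
  functional in the first case and its form as an evaluation in the second.\<close>

definition real_sublinear :: "('a::real_vector \<Rightarrow> real) \<Rightarrow> bool" where
  "real_sublinear p \<longleftrightarrow>
    (\<forall>x y. p (x + y) \<le> p x + p y) \<and> (\<forall>t\<ge>0. \<forall>x. p (t *\<^sub>R x) = t * p x)"

text \<open>The inequality for \<open>inverse t\<close> is the reverse inequality for
  \<open>t\<close>, and the factors 2 and 1/2 at the origin force \<open>p 0 = 0\<close>.\<close>

lemma real_sublinearI:
  assumes add: "\<And>x y. p (x + y) \<le> p x + p y"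
    and scale: "\<And>t x. t > 0 \<Longrightarrow> p (t *\<^sub>R x) \<le> t * p x"
  shows "real_sublinear p"
proof -
  have zero: "p 0 = 0"
    using scale[of 2 0] scale[of "1/2" 0] by simp
  have "p (t *\<^sub>R x) = t * p x" if "t \<ge> 0" for t x
  proof (cases "t = 0")
    case False
    with that have "t > 0" by simp
    have "t * p x \<le> p (t *\<^sub>R x)"
      using scale[of "inverse t" "t *\<^sub>R x"] \<open>t > 0\<close> by (simp add: field_simps)
    with scale[OF \<open>t > 0\<close>, of x] show ?thesis by simp
  qed (simp add: zero)
  with add show ?thesis by (simp add: real_sublinear_def)
qed

lemma real_sublinear_zero: "real_sublinear p \<Longrightarrow> p 0 = 0"
  unfolding real_sublinear_def by (metis mult_zero_left order_refl scaleR_zero_left)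

lemma real_sublinear_minus_le:
  assumes "real_sublinear p"
  shows "- p (- x) \<le> p x"
proof -
  have "p (x + - x) \<le> p x + p (- x)"
    using assms unfolding real_sublinear_def by blast
  with real_sublinear_zero[OF assms] show ?thesis by simp
qed

text \<open>
  For a minimal sublinear functional \<open>p\<close> this gives \<open>q = p\<close>, hence additivity. The functional \<open>q\<close>
  also satisfies \<open>q (- y) \<le> - p y\<close>, so a linear functional below \<open>q\<close> agrees with \<open>p\<close> at \<open>y\<close>.
\<close>

lemma real_sublinear_lower:
  fixes p :: "'a::real_vector \<Rightarrow> real"
  assumes p: "real_sublinear p"
  obtains q where "real_sublinear q" "q \<le> p" "\<And>v. q v \<le> p (v + y) - p y"
proof -
  have sub: "p (a + b) \<le> p a + p b" and hom: "t \<ge> 0 \<Longrightarrow> p (t *\<^sub>R a) = t * p a" for a b t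
    using p by (auto simp: real_sublinear_def)
  \<comment> \<open>A sublinear \<open>r \<le> p\<close> with \<open>r (- y) \<le> - p y\<close>
    satisfies \<open>r v \<le> r (v + t *\<^sub>R y) + t * r (- y) \<le> p (v + t *\<^sub>R y) - t *
    p y\<close>. So \<open>q\<close> is the largest candidate.\<close>
  define q where "q v = (INF t\<in>{0..}. p (v + t *\<^sub>R y) - t * p y)" for v
  \<comment> \<open>Subadditivity for \<open>t *\<^sub>R y = (v + t *\<^sub>R y) + (- v)\<close>
    gives a bound free of \<open>t\<close>.\<close>
  have bdd: "bdd_below ((\<lambda>t. p (v + t *\<^sub>R y) - t * p y) ` {0..})" for v
  proof (rule bdd_belowI2)
    show "- p (- v) \<le> p (v + t *\<^sub>R y) - t * p y" if "t \<in> {0..}" for t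
      using sub[of "v + t *\<^sub>R y" "- v"] hom[of t y] that by simp
  qed
  have q_le: "q v \<le> p (v + t *\<^sub>R y) - t * p y" if "t \<ge> 0" for v t
    unfolding q_def by (rule cINF_lower[OF bdd]) (use that in simp)
  have le_q: "b \<le> q v" if "\<And>t. t \<ge> 0 \<Longrightarrow> b \<le> p (v + t *\<^sub>R y) - t * p y" for b v
    unfolding q_def by (rule cINF_greatest) (use that in auto)
  have "real_sublinear q"
  proof (rule real_sublinearI)
    fix v w
    \<comment> \<open>Parameters \<open>t\<close> for \<open>v\<close> and \<open>s\<close> for
      \<open>w\<close> combine to \<open>t + s\<close> for \<open>v + w\<close>; the infimum is
      taken over \<open>s\<close> first and over \<open>t\<close> afterwards.\<close>
    have "q (v + w) - q w \<le> p (v + t *\<^sub>R y) - t * p y" if t: "t \<ge> 0" for t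
    proof -
      have "q (v + w) - (p (v + t *\<^sub>R y) - t * p y) \<le> p (w + s *\<^sub>R y) - s * p y" if s: "s \<ge> 0" for s
        using q_le[of "t + s" "v + w"] sub[of "v + t *\<^sub>R y" "w + s *\<^sub>R y"] s t
        by (simp add: algebra_simps)
      from le_q[OF this] show ?thesis by simp
    qed
    from le_q[OF this] show "q (v + w) \<le> q v + q w" by simp
  next
    fix c :: real and v :: 'a
    assume c: "c > 0"
    have "q (c *\<^sub>R v) / c \<le> p (v + t *\<^sub>R y) - t * p y" if t: "t \<ge> 0" for t
      using q_le[of "c * t" "c *\<^sub>R v"] hom[of c "v + t *\<^sub>R y"] c t
      by (simp add: field_simps scaleR_add_right)
    from le_q[OF this] show "q (c *\<^sub>R v) \<le> c * q v"
      using c by (simp add: field_simps)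
  qed
  moreover have "q \<le> p"
    using q_le[of 0] by (simp add: le_fun_def)
  moreover have "q v \<le> p (v + y) - p y" for v
    using q_le[of 1 v] by simp
  ultimately show ?thesis by (rule that)
qed

lemma exists_linear_le:
  fixes p :: "'a::real_vector \<Rightarrow> real"
  assumes p: "real_sublinear p"
  obtains L where "linear L" "L \<le> p"
proof -
  define A where "A = {q. real_sublinear q \<and> q \<le> p}"
  \<comment> \<open>The order is reversed, so that the maximal element given by Zorn's lemma is a
    minimal sublinear functional.\<close>
  let ?R = "relation_of (\<lambda>q r. r \<le> q) A"
  have "\<exists>m\<in>A. \<forall>q\<in>A. q \<le> m \<longrightarrow> q = m"
  proof (rule predicate_Zorn)
    show "partial_order_on A ?R"
      by (rule partial_order_on_relation_ofI) auto
    fix C assume C: "C \<in> Chains ?R"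
    then have CA: "C \<subseteq> A" by (rule Chains_relation_of)
    have chain: "q \<le> r \<or> r \<le> q" if "q \<in> C" "r \<in> C" for q r
      using C that by (auto simp: Chains_def relation_of_def)
    show "\<exists>u\<in>A. \<forall>q\<in>C. u \<le> q"
    proof (cases "C = {}")
      case True
      then show ?thesis using p by (auto simp: A_def)
    next
      case False
      define u where "u v = (INF q\<in>C. q v)" for v
      \<comment> \<open>All members of the chain lie below \<open>p\<close>, so
        \<open>- p (- v)\<close> bounds their values at \<open>v\<close> from below and the
        pointwise infimum is real.\<close>
      have bdd: "bdd_below ((\<lambda>q. q v) ` C)" for v
      proof (rule bdd_belowI2)
        fix q assume "q \<in> C"
        with CA have "real_sublinear q" "q (- v) \<le> p (- v)"
          by (auto simp: A_def le_fun_def)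
        with real_sublinear_minus_le[of q v] show "- p (- v) \<le> q v" by linarith
      qed
      have u_le: "u v \<le> q v" if "q \<in> C" for v q
        unfolding u_def by (rule cINF_lower[OF bdd that])
      have le_u: "b \<le> u v" if "\<And>q. q \<in> C \<Longrightarrow> b \<le> q v" for b v
        unfolding u_def by (rule cINF_greatest[OF False that])
      have "real_sublinear u"
      proof (rule real_sublinearI)
        fix v w
        have "u (v + w) - u w \<le> u v"
        proof (rule le_u)
          fix q assume q: "q \<in> C"
          have "u (v + w) - q v \<le> u w"
          proof (rule le_u)
            fix r assume r: "r \<in> C"
            \<comment> \<open>Subadditivity survives the infimum because one member of the chain
              lies below both \<open>q\<close> and \<open>r\<close>.\<close>
            from chain[OF q r] obtain s where s: "s \<in> C" "s \<le> q" "s \<le> r"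
              using q r by blast
            have "s (v + w) \<le> s v + s w"
              using s CA by (auto simp: A_def real_sublinear_def)
            with u_le[OF s(1), of "v + w"] le_funD[OF s(2), of v] le_funD[OF s(3), of w]
            show "u (v + w) - q v \<le> r w" by linarith
          qed
          then show "u (v + w) - u w \<le> q v" by simp
        qed
        then show "u (v + w) \<le> u v + u w" by simp
      next
        fix c :: real and v :: 'a
        assume c: "c > 0"
        have "u (c *\<^sub>R v) / c \<le> u v"
        proof (rule le_u)
          fix q assume q: "q \<in> C"
          have "q (c *\<^sub>R v) = c * q v"
            using q CA c by (auto simp: A_def real_sublinear_def)
          with u_le[OF q, of "c *\<^sub>R v"] c show "u (c *\<^sub>R v) / c \<le> q v"
            by (simp add: field_simps)
        qed
        then show "u (c *\<^sub>R v) \<le> c * u v"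
          using c by (simp add: field_simps)
      qed
      moreover from False obtain q where "q \<in> C" by blast
      then have "u \<le> q" "q \<le> p"
        using CA u_le by (auto simp: A_def le_fun_def)
      then have "u \<le> p" by (rule order_trans)
      ultimately show ?thesis using u_le by (auto simp: A_def le_fun_def)
    qed
  qed
  then obtain L where L: "real_sublinear L" "L \<le> p"
    and min: "\<And>q. real_sublinear q \<Longrightarrow> q \<le> p \<Longrightarrow> q \<le> L \<Longrightarrow> q = L"
    by (auto simp: A_def)
  have add: "L (v + y) = L v + L y" for v y
  proof -
    obtain q where q: "real_sublinear q" "q \<le> L" "\<And>v. q v \<le> L (v + y) - L y"
      using real_sublinear_lower[OF L(1)] by blast
    \<comment> \<open>By minimality the lowered functional is \<open>L\<close> itself, and its
      defining bound becomes superadditivity.\<close>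
    have "q = L" using min[OF q(1)] q(2) L(2) by (meson order_trans)
    with q(3)[of v] have "L v + L y \<le> L (v + y)" by simp
    moreover have "L (v + y) \<le> L v + L y"
      using L(1) unfolding real_sublinear_def by blast
    ultimately show ?thesis by simp
  qed
  have neg: "L (- v) = - L v" for v
    using add[of v "- v"] real_sublinear_zero[OF L(1)] by simp
  have pos: "L (c *\<^sub>R v) = c * L v" if "c \<ge> 0" for c v
    using L(1) that by (auto simp: real_sublinear_def)
  have "L (c *\<^sub>R v) = c * L v" for c v
    using pos[of c v] pos[of "- c" v] neg[of "c *\<^sub>R v"] by (cases "c \<ge> 0") simp_all
  with add have "linear L" by (auto intro!: linearI)
  from this L(2) show ?thesis by (rule that)
qed

text \<open>The supporting form of Hahn-Banach without extension from a subspace: once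
  \<open>p\<close> is lowered along \<open>z\<close>, a linear minorant has only one possible value
  at \<open>z\<close>.\<close>

lemma exists_linear_le_supporting:
  fixes p :: "'a::real_vector \<Rightarrow> real"
  assumes p: "real_sublinear p"
  obtains L where "linear L" "L \<le> p" "L z = p z"
proof -
  obtain q where q: "real_sublinear q" "q \<le> p" "\<And>v. q v \<le> p (v + z) - p z"
    using real_sublinear_lower[OF p] by blast
  obtain L where L: "linear L" "L \<le> q"
    using exists_linear_le[OF q(1)] .
  have "L (- z) \<le> - p z"
    using le_funD[OF L(2), of "- z"] q(3)[of "- z"] real_sublinear_zero[OF p] by simp
  then have "p z \<le> L z"
    by (simp add: linear_neg[OF L(1)])
  moreover have "L \<le> p" using L(2) q(2) by (rule order_trans)
  ultimately show ?thesis
    using that[OF L(1)] by (simp add: le_fun_def order_antisym)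
qed

text \<open>The absorbing set \<open>U\<close> stands in for a neighbourhood of 0, and a linear
  functional below the gauge of a translate of \<open>C + U\<close> separates. A point of
  \<open>U\<close> with \<open>L u > 0\<close> later makes the separation from \<open>C\<close>
  strict.\<close>

lemma convex_absorbing_separation:
  fixes U C :: "'a::real_vector set"
  assumes U: "convex U" "\<And>v. \<exists>t>0. t *\<^sub>R v \<in> U"
    and C: "convex C" "C \<noteq> {}"
    and z: "\<And>c u. c \<in> C \<Longrightarrow> u \<in> U \<Longrightarrow> z \<noteq> c + u"
  obtains L :: "'a \<Rightarrow> real" where "linear L" "\<And>c u. c \<in> C \<Longrightarrow> u \<in> U \<Longrightarrow> L c + L u \<le> L z"
    "\<exists>u\<in>U. L u > 0"
proof -
  obtain c0 where c0: "c0 \<in> C" using C(2) by blast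
  \<comment> \<open>Translation by \<open>c0\<close> places \<open>U\<close>, hence 0, inside
    \<open>B\<close>; therefore \<open>B\<close> is absorbing as well.\<close>
  define B where "B = {c + u - c0 | c u. c \<in> C \<and> u \<in> U}"
  have zero_U: "0 \<in> U" using U(2)[of 0] by auto
  have UB: "u \<in> B" if "u \<in> U" for u
    using that c0 unfolding B_def by (intro CollectI exI[of _ c0] exI[of _ u]) simp
  have zero_B: "0 \<in> B" by (rule UB[OF zero_U])
  have z_notin: "z - c0 \<notin> B"
    using z by (auto simp: B_def)
  have conv: "s *\<^sub>R a + t *\<^sub>R b \<in> B" if ab: "a \<in> B" "b \<in> B" "s \<ge> 0" "t \<ge> 0" "s + t = 1" for a b s t
  proof -
    obtain c u d v where *: "a = c + u - c0" "b = d + v - c0" "c \<in> C" "d \<in> C" "u \<in> U" "v \<in> U"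
      using ab(1,2) by (auto simp: B_def)
    have "s *\<^sub>R a + t *\<^sub>R b = (s *\<^sub>R c + t *\<^sub>R d) + (s *\<^sub>R u + t *\<^sub>R v) - (s + t) *\<^sub>R c0"
      unfolding *(1,2) by (simp add: algebra_simps)
    then have "s *\<^sub>R a + t *\<^sub>R b = (s *\<^sub>R c + t *\<^sub>R d) + (s *\<^sub>R u + t *\<^sub>R v) - c0"
      using ab(5) by simp
    moreover have "s *\<^sub>R c + t *\<^sub>R d \<in> C" "s *\<^sub>R u + t *\<^sub>R v \<in> U"
      using * ab U(1) C(1) by (auto simp: convex_def)
    ultimately show ?thesis by (auto simp: B_def)
  qed
  define S where "S v = {t. t > 0 \<and> (\<exists>b\<in>B. v = t *\<^sub>R b)}" for v
  \<comment> \<open>The Minkowski gauge of \<open>B\<close>.\<close>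
  define p where "p v = Inf (S v)" for v
  have bdd: "bdd_below (S v)" for v
    by (rule bdd_belowI[of _ 0]) (auto simp: S_def)
  have ne: "S v \<noteq> {}" for v
  proof -
    obtain t where t: "t > 0" "t *\<^sub>R v \<in> U" using U(2) by blast
    then have "inverse t \<in> S v"
      using UB[OF t(2)] by (auto simp: S_def intro!: bexI[of _ "t *\<^sub>R v"])
    then show ?thesis by blast
  qed
  have p_le: "p v \<le> t" if "t \<in> S v" for v t
    unfolding p_def by (rule cInf_lower[OF that bdd])
  have le_p: "b \<le> p v" if "\<And>t. t \<in> S v \<Longrightarrow> b \<le> t" for b v
    unfolding p_def by (rule cInf_greatest[OF ne that])
  have p: "real_sublinear p"
  proof (rule real_sublinearI)
    fix v w
    have "p (v + w) - p w \<le> p v"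
    proof (rule le_p)
      fix t assume t: "t \<in> S v"
      have "p (v + w) - t \<le> p w"
      proof (rule le_p)
        fix s assume s: "s \<in> S w"
        obtain a b where *: "t > 0" "s > 0" "a \<in> B" "b \<in> B" "v = t *\<^sub>R a" "w = s *\<^sub>R b"
          using s t by (auto simp: S_def)
        have pos: "t + s \<noteq> 0" using * by simp
        \<comment> \<open>The sum \<open>t *\<^sub>R a + s *\<^sub>R b\<close> is
          \<open>t + s\<close> times a convex combination of \<open>a\<close> and
          \<open>b\<close>.\<close>
        have "(t / (t + s)) *\<^sub>R a + (s / (t + s)) *\<^sub>R b \<in> B"
          by (rule conv) (use *(1-4) in \<open>auto simp: add_divide_distrib[symmetric]\<close>)
        moreover have "v + w = (t + s) *\<^sub>R ((t / (t + s)) *\<^sub>R a + (s / (t + s)) *\<^sub>R b)"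
          using pos by (simp add: *(5,6) scaleR_add_right)
        ultimately have "t + s \<in> S (v + w)"
          using * by (auto simp: S_def)
        from p_le[OF this] show "p (v + w) - t \<le> s" by simp
      qed
      then show "p (v + w) - p w \<le> t" by simp
    qed
    then show "p (v + w) \<le> p v + p w" by simp
  next
    fix c :: real and v :: 'a
    assume c: "c > 0"
    have "p (c *\<^sub>R v) / c \<le> p v"
    proof (rule le_p)
      fix t assume "t \<in> S v"
      then have "c * t \<in> S (c *\<^sub>R v)"
        using c by (auto simp: S_def)
      from p_le[OF this] c show "p (c *\<^sub>R v) / c \<le> t" by (simp add: field_simps)
    qed
    then show "p (c *\<^sub>R v) \<le> c * p v"
      using c by (simp add: field_simps)
  qed
  have p_B: "p b \<le> 1" if "b \<in> B" for b
    by (rule p_le) (use that in \<open>auto simp: S_def\<close>)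
  \<comment> \<open>A factor below 1 would write \<open>z - c0\<close> as a convex combination of 0
    and a point of \<open>B\<close>.\<close>
  have p_z: "1 \<le> p (z - c0)"
  proof (rule le_p, rule ccontr)
    fix t assume "t \<in> S (z - c0)" "\<not> 1 \<le> t"
    then obtain b where "t > 0" "t < 1" "b \<in> B" "z - c0 = t *\<^sub>R b"
      by (auto simp: S_def)
    with conv[OF _ zero_B, of b t "1 - t"] z_notin show False by simp
  qed
  obtain L where L: "linear L" "L \<le> p" "L (z - c0) = p (z - c0)"
    using exists_linear_le_supporting[OF p] .
  have sep: "L c + L u \<le> L z" if "c \<in> C" "u \<in> U" for c u
  proof -
    have "c + u - c0 \<in> B" using that by (auto simp: B_def)
    then have "L (c + u - c0) \<le> L (z - c0)"
      using le_funD[OF L(2), of "c + u - c0"] p_B p_z L(3) by fastforce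
    then show ?thesis by (simp add: linear_add[OF L(1)] linear_diff[OF L(1)])
  qed
  \<comment> \<open>\<open>L\<close> is at least 1 at \<open>z - c0\<close>, so it is positive at
    the multiple that lies in \<open>U\<close>.\<close>
  obtain t where "t > 0" "t *\<^sub>R (z - c0) \<in> U" using U(2) by blast
  moreover from this have "L (t *\<^sub>R (z - c0)) > 0"
    using L(3) p_z by (simp add: linear_cmul[OF L(1)])
  ultimately show ?thesis using that[OF L(1)] sep by blast
qed

section \<open>Locally convex spaces and their duals\<close>

lemma tendsto_scaleR_left_zero:
  fixes x :: "'a::locally_convex_space"
  shows "((\<lambda>t. t *\<^sub>R x) \<longlongrightarrow> 0) (nhds 0)"
proof -
  have "LIM t nhds (0::real). (t, x) :> nhds 0 \<times>\<^sub>F nhds x"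
    by (intro filterlim_Pair filterlim_ident tendsto_const)
  from filterlim_compose[OF tendsto_scaleR_Pair[of 0 x] this] show ?thesis by simp
qed

lemma continuous_on_scaleR_const:
  "continuous_on UNIV (\<lambda>x::'a::locally_convex_space. c *\<^sub>R x)"
proof -
  have "LIM y at x. (c, y) :> nhds c \<times>\<^sub>F nhds x" for x :: 'a
    by (intro filterlim_Pair tendsto_const tendsto_ident_at)
  from filterlim_compose[OF tendsto_scaleR_Pair this] show ?thesis
    by (simp add: continuous_on_def)
qed

text \<open>A whole interval of factors is provided, so that the factor can be shrunk further when a
  product neighbourhood has to absorb.\<close>

lemma open_absorbing:
  fixes W :: "'a::locally_convex_space set"
  assumes "open W" "0 \<in> W"
  obtains s where "s > 0" "\<And>t. 0 \<le> t \<Longrightarrow> t \<le> s \<Longrightarrow> t *\<^sub>R x \<in> W"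
proof -
  have "\<forall>\<^sub>F t in nhds 0. t *\<^sub>R x \<in> W"
    using tendsto_scaleR_left_zero[of x] assms unfolding tendsto_def by blast
  then obtain d where d: "d > 0" "\<And>t. dist t 0 < d \<Longrightarrow> t *\<^sub>R x \<in> W"
    unfolding eventually_nhds_metric by blast
  show ?thesis
    by (rule that[of "d / 2"]) (use d in auto)
qed

lemma symmetric_convex_nhd:
  fixes U :: "'a::locally_convex_space set"
  assumes "open U" "0 \<in> U"
  obtains W where "open W" "convex W" "0 \<in> W" "W \<subseteq> U" "\<And>w. w \<in> W \<Longrightarrow> - w \<in> W"
proof -
  obtain V where V: "open V" "convex V" "0 \<in> V" "V \<subseteq> U"
    using locally_convex_nhd_basis[OF assms] .
  have "open (V \<inter> uminus -` V)"
    using V(1) by (auto intro!: open_Int open_vimage continuous_on_minus continuous_on_id)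
  moreover have "convex (uminus -` V)"
    using V(2) by (intro convex_linear_vimage) (auto intro!: linearI)
  then have "convex (V \<inter> uminus -` V)"
    using V(2) by (rule convex_Int[rotated])
  ultimately show ?thesis
    using V by (intro that[of "V \<inter> uminus -` V"]) auto
qed

text \<open>Symmetry of \<open>W\<close> turns the upper bound into a bound on the absolute value,
  and scaling carries it to small neighbourhoods of any point.\<close>

lemma linear_continuous_of_bounded:
  fixes l :: "'a::locally_convex_space \<Rightarrow> real"
  assumes l: "linear l" and W: "open W" "0 \<in> W" "\<And>w. w \<in> W \<Longrightarrow> - w \<in> W"
    and bound: "\<And>w. w \<in> W \<Longrightarrow> l w \<le> M"
  shows "continuous_on UNIV l"
  unfolding continuous_on_def
proof (intro ballI tendstoI)
  fix x :: 'a and e :: real assume e: "e > 0"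
  \<comment> \<open>The maximum makes \<open>N\<close> positive, and the added 1 makes it strictly
    larger than \<open>M\<close>.\<close>
  define N where "N = max M 0 + 1"
  have N: "N > 0" "M < N" by (auto simp: N_def)
  \<comment> \<open>The displacement is magnified so that \<open>\<bar>l (g y)\<bar> < N\<close>
    says exactly that \<open>l y\<close> is within \<open>e\<close> of \<open>l x\<close>.\<close>
  define g where "g y = (N / e) *\<^sub>R (y - x)" for y
  have "continuous_on UNIV g"
    unfolding g_def
    by (rule continuous_on_compose2[OF continuous_on_scaleR_const])
      (auto intro!: continuous_on_diff continuous_on_id continuous_on_const)
  then have "open (g -` W)"
    using W(1) by (simp add: open_vimage)
  moreover have "x \<in> g -` W"
    using W(2) by (simp add: g_def)
  ultimately have "\<forall>\<^sub>F y in nhds x. y \<in> g -` W"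
    by (rule eventually_nhds_in_open)
  then have "\<forall>\<^sub>F y in nhds x. dist (l y) (l x) < e"
  proof (rule eventually_mono)
    fix y assume "y \<in> g -` W"
    then have "l (g y) \<le> M" "l (- g y) \<le> M"
      by (auto intro!: bound W(3))
    then have "\<bar>l (g y)\<bar> < N"
      using linear_neg[OF l, of "g y"] N(2) by simp
    moreover have "\<bar>l (g y)\<bar> = N / e * dist (l y) (l x)"
      using N(1) e by (simp add: g_def linear_cmul[OF l] linear_diff[OF l] dist_real_def abs_mult)
    ultimately have "N * dist (l y) (l x) < N * e"
      using e by (simp add: pos_divide_less_eq)
    then show "dist (l y) (l x) < e"
      using N(1) by simp
  qed
  then show "\<forall>\<^sub>F y in at x within UNIV. dist (l y) (l x) < e"
    unfolding eventually_at_filter by (rule eventually_mono) simp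
qed

section \<open>The weak-star dual: cylinder neighbourhoods, evaluations and separation\<close>

lemma dual_apply_add [simp]: "dual_apply (\<phi> + \<psi>) x = dual_apply \<phi> x + dual_apply \<psi> x"
  by transfer simp

lemma dual_apply_diff [simp]: "dual_apply (\<phi> - \<psi>) x = dual_apply \<phi> x - dual_apply \<psi> x"
  by transfer simp

lemma dual_apply_scaleR [simp]: "dual_apply (c *\<^sub>R \<phi>) x = c * dual_apply \<phi> x"
  by transfer simp

lemma dual_apply_minus [simp]: "dual_apply (- \<phi>) x = - dual_apply \<phi> x"
  by transfer simp

lemma dual_apply_zero [simp]: "dual_apply 0 x = 0"
  by transfer simp

lemma dual_apply_sum [simp]: "dual_apply (\<Sum>i\<in>I. \<phi> i) x = (\<Sum>i\<in>I. dual_apply (\<phi> i) x)"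
  by (induction I rule: infinite_finite_induct) auto

lemma linear_dual_apply: "linear (dual_apply \<phi>)"
  by transfer simp

lemma linear_dual_apply_left: "linear (\<lambda>\<phi>. dual_apply \<phi> x)"
  by (rule linearI) auto

lemma dual_apply_Dual:
  "linear l \<Longrightarrow> continuous_on UNIV l \<Longrightarrow> dual_apply (Dual l) = l"
  by (simp add: Dual_inverse)

lemma continuous_on_dual_apply: "continuous_on UNIV (\<lambda>\<phi>. dual_apply \<phi> x)"
  unfolding continuous_on_open_vimage[OF open_UNIV] open_dual_def
  by (auto simp: vimage_def intro!: generate_topology.Basis)

text \<open>Cylinders over finitely many points suffice. The finite set \<open>F\<close> is kept
  explicit because it later determines the form of the separating functional.\<close>

lemma open_dual_basic_nhd:
  fixes S :: "'a::locally_convex_space dual set"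
  assumes "open S" "\<phi> \<in> S"
  obtains F \<delta> where "finite F" "\<delta> > 0"
    "\<And>\<psi>. (\<And>x. x \<in> F \<Longrightarrow> \<bar>dual_apply \<psi> x\<bar> < \<delta>) \<Longrightarrow> \<phi> + \<psi> \<in> S"
proof -
  from assms have "\<exists>F \<delta>. finite F \<and> \<delta> > 0 \<and>
    (\<forall>\<psi>. (\<forall>x\<in>F. \<bar>dual_apply \<psi> x\<bar> < \<delta>) \<longrightarrow> \<phi> + \<psi> \<in> S)"
    unfolding open_dual_def
  proof (induction S rule: generate_topology.induct)
    case UNIV
    show ?case by (intro exI[of _ "{}"] exI[of _ 1]) auto
  next
    case (Int S T)
    then have "\<phi> \<in> S" "\<phi> \<in> T" by auto
    obtain F \<delta> where F: "finite F" "\<delta> > 0"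
      "\<forall>\<psi>. (\<forall>x\<in>F. \<bar>dual_apply \<psi> x\<bar> < \<delta>) \<longrightarrow> \<phi> + \<psi> \<in> S"
      using Int.IH(1)[OF \<open>\<phi> \<in> S\<close>] by (elim exE conjE)
    obtain G \<epsilon> where G: "finite G" "\<epsilon> > 0"
      "\<forall>\<psi>. (\<forall>x\<in>G. \<bar>dual_apply \<psi> x\<bar> < \<epsilon>) \<longrightarrow> \<phi> + \<psi> \<in> T"
      using Int.IH(2)[OF \<open>\<phi> \<in> T\<close>] by (elim exE conjE)
    show ?case
      by (intro exI[of _ "F \<union> G"] exI[of _ "min \<delta> \<epsilon>"]) (use F G in auto)
  next
    case (UN K)
    then obtain S where S: "S \<in> K" "\<phi> \<in> S" by blast
    from UN.IH[OF S] show ?case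
      by (elim exE conjE, intro exI conjI) (use S(1) in auto)
  next
    case (Basis S)
    then obtain x T where T: "S = {\<phi>. dual_apply \<phi> x \<in> T}" "open T" "dual_apply \<phi> x \<in> T"
      by blast
    then obtain \<delta> where "\<delta> > 0" "\<And>r. dist r (dual_apply \<phi> x) < \<delta> \<Longrightarrow> r \<in> T"
      by (auto simp: open_dist)
    then show ?case
      by (intro exI[of _ "{x}"] exI[of _ \<delta>]) (auto simp: T(1) dist_real_def)
  qed
  then obtain F \<delta> where "finite F" "\<delta> > 0"
    "\<forall>\<psi>. (\<forall>x\<in>F. \<bar>dual_apply \<psi> x\<bar> < \<delta>) \<longrightarrow> \<phi> + \<psi> \<in> S"
    by (elim exE conjE)
  then show ?thesis by (intro that[of F \<delta>]) auto
qed

text \<open>A functional that vanishes on the common kernel of finitely many evaluations is a linear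
  combination of them, hence an evaluation itself. This brings functionals on the dual back to
  points of the space.\<close>

lemma evaluation_if_vanishing:
  fixes L :: "'a::locally_convex_space dual \<Rightarrow> real"
  assumes "finite F" "linear L" "\<And>\<psi>. (\<forall>x\<in>F. dual_apply \<psi> x = 0) \<Longrightarrow> L \<psi> = 0"
  obtains y where "\<And>\<psi>. L \<psi> = dual_apply \<psi> y"
proof -
  from assms have "\<exists>y. \<forall>\<psi>. L \<psi> = dual_apply \<psi> y"
  proof (induction F arbitrary: L)
    case empty
    then show ?case
      by (intro exI[of _ 0]) (simp add: linear_0[OF linear_dual_apply])
  next
    case (insert x F)
    note L = insert.prems
    show ?case
    proof (cases "\<exists>\<psi>. (\<forall>y\<in>F. dual_apply \<psi> y = 0) \<and> dual_apply \<psi> x \<noteq> 0")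
      case False
      have "L \<psi> = 0" if "\<forall>y\<in>F. dual_apply \<psi> y = 0" for \<psi>
        using that False by (intro L(2)) auto
      then show ?thesis by (rule insert.IH[OF L(1)])
    next
      case True
      then obtain \<psi> where \<psi>: "\<forall>y\<in>F. dual_apply \<psi> y = 0" "dual_apply \<psi> x \<noteq> 0" by blast
      \<comment> \<open>Normalized to 1 at \<open>x\<close> and zero on \<open>F\<close>, so
        subtracting \<open>dual_apply \<theta> x *\<^sub>R \<psi>\<^sub>0\<close> clears the value
        at \<open>x\<close> without disturbing those on \<open>F\<close>.\<close>
      define \<psi>\<^sub>0 where "\<psi>\<^sub>0 = inverse (dual_apply \<psi> x) *\<^sub>R \<psi>"
      have \<psi>\<^sub>0: "\<forall>y\<in>F. dual_apply \<psi>\<^sub>0 y = 0" "dual_apply \<psi>\<^sub>0 x = 1"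
        using \<psi> by (auto simp: \<psi>\<^sub>0_def)
      define c where "c = L \<psi>\<^sub>0"
      have "\<exists>y. \<forall>\<theta>. L \<theta> - c * dual_apply \<theta> x = dual_apply \<theta> y"
      proof (rule insert.IH)
        show "linear (\<lambda>\<theta>. L \<theta> - c * dual_apply \<theta> x)"
          by (rule linearI) (auto simp: linear_add[OF L(1)] linear_cmul[OF L(1)] algebra_simps)
        fix \<theta> :: "'a dual" assume \<theta>: "\<forall>y\<in>F. dual_apply \<theta> y = 0"
        have "L (\<theta> - dual_apply \<theta> x *\<^sub>R \<psi>\<^sub>0) = 0"
          by (rule L(2)) (use \<theta> \<psi>\<^sub>0 in auto)
        then show "L \<theta> - c * dual_apply \<theta> x = 0"
          by (simp add: c_def linear_diff[OF L(1)] linear_cmul[OF L(1)] mult.commute)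
      qed
      then obtain y where y: "\<forall>\<theta>. L \<theta> - c * dual_apply \<theta> x = dual_apply \<theta> y" ..
      have "L \<theta> = dual_apply \<theta> (y + c *\<^sub>R x)" for \<theta>
        using y[rule_format, of \<theta>]
        by (simp add: linear_add[OF linear_dual_apply] linear_cmul[OF linear_dual_apply])
      then show ?thesis by blast
    qed
  qed
  then show ?thesis by (elim exE) (rule that, erule spec)
qed

text \<open>The separating functional is bounded above on a cylinder, which contains the whole
  common kernel of the points in \<open>F\<close>. So it vanishes on this kernel and is an
  evaluation.\<close>

lemma weak_star_separation:
  fixes C :: "'a::locally_convex_space dual set"
  assumes C: "convex C" "C \<noteq> {}" and \<phi>: "\<phi> \<notin> closure C"
  obtains x b where "\<And>\<psi>. \<psi> \<in> C \<Longrightarrow> dual_apply \<psi> x \<le> b" "b < dual_apply \<phi> x"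
proof -
  obtain F \<delta> where F: "finite F" "\<delta> > 0"
    and nhd: "\<And>\<psi>. (\<And>x. x \<in> F \<Longrightarrow> \<bar>dual_apply \<psi> x\<bar> < \<delta>) \<Longrightarrow> \<phi> + \<psi> \<in> - closure C"
    by (rule open_dual_basic_nhd[of "- closure C" \<phi>]) (use \<phi> in auto)
  define U where "U = {\<psi>::'a dual. \<forall>x\<in>F. \<bar>dual_apply \<psi> x\<bar> < \<delta>}"
  have "U = (\<Inter>x\<in>F. (\<lambda>\<psi>. dual_apply \<psi> x) -` {-\<delta><..<\<delta>})"
    by (auto simp: U_def abs_less_iff minus_less_iff)
  then have U: "convex U"
    by (auto intro!: convex_INT convex_linear_vimage linear_dual_apply_left)
  have absorb: "\<exists>t>0. t *\<^sub>R \<psi> \<in> U" for \<psi>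
  proof (intro exI conjI)
    \<comment> \<open>The added 1 makes \<open>N\<close> positive and strictly larger than every
      \<open>\<bar>dual_apply \<psi> x\<bar>\<close> with \<open>x\<close> in
      \<open>F\<close>.\<close>
    define N where "N = 1 + (\<Sum>x\<in>F. \<bar>dual_apply \<psi> x\<bar>)"
    have N: "N > 0"
      unfolding N_def by (intro add_pos_nonneg sum_nonneg) auto
    with F(2) show "\<delta> / N > 0" by simp
    show "(\<delta> / N) *\<^sub>R \<psi> \<in> U"
      unfolding U_def
    proof safe
      fix x assume "x \<in> F"
      then have "\<bar>dual_apply \<psi> x\<bar> < N"
        using member_le_sum[of x F "\<lambda>x. \<bar>dual_apply \<psi> x\<bar>"] F(1) by (simp add: N_def)
      then show "\<bar>dual_apply ((\<delta> / N) *\<^sub>R \<psi>) x\<bar> < \<delta>"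
        using N F(2) by (simp add: abs_mult pos_divide_less_eq)
    qed
  qed
  have "\<phi> \<noteq> c + u" if "c \<in> C" "u \<in> U" for c u
  proof
    assume "\<phi> = c + u"
    then have "\<phi> + - u = c" by simp
    moreover have "\<phi> + - u \<in> - closure C"
      by (rule nhd) (use that(2) in \<open>simp add: U_def\<close>)
    ultimately show False using that(1) closure_subset by auto
  qed
  with convex_absorbing_separation[OF U absorb C]
  obtain L :: "'a dual \<Rightarrow> real" where L: "linear L"
    "\<And>c u. c \<in> C \<Longrightarrow> u \<in> U \<Longrightarrow> L c + L u \<le> L \<phi>" "\<exists>u\<in>U. L u > 0"
    by metis
  obtain c where c: "c \<in> C" using C(2) by blast
  have zero: "L \<psi> = 0" if "\<forall>x\<in>F. dual_apply \<psi> x = 0" for \<psi>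
  proof (rule ccontr)
    assume nz: "L \<psi> \<noteq> 0"
    \<comment> \<open>Chosen so that \<open>s * L \<psi> = \<bar>L \<phi> - L c\<bar> + 1\<close>,
      which exceeds the separation bound \<open>L \<phi> - L c\<close>.\<close>
    define s where "s = (\<bar>L \<phi> - L c\<bar> + 1) / L \<psi>"
    have "s *\<^sub>R \<psi> \<in> U" using that F(2) by (simp add: U_def)
    from L(2)[OF c this] nz show False by (simp add: linear_cmul[OF L(1)] s_def)
  qed
  obtain y where y: "\<And>\<psi>. L \<psi> = dual_apply \<psi> y"
    using evaluation_if_vanishing[OF F(1) L(1) zero] by metis
  obtain u where u: "u \<in> U" "L u > 0" using L(3) by blast
  show ?thesis
  proof (rule that)
    show "dual_apply \<psi> y \<le> L \<phi> - L u" if "\<psi> \<in> C" for \<psi>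
      using L(2)[OF that u(1)] y by simp
    show "L \<phi> - L u < dual_apply \<phi> y"
      using u(2) y by simp
  qed
qed

section \<open>Subdifferentials and conjugates of sublinear functions\<close>

lemma sublinear_zero: "sublinear f \<Longrightarrow> f 0 = 0"
  by (simp add: sublinear_def)

lemma sublinear_add_le:
  "sublinear f \<Longrightarrow> f x < \<infinity> \<Longrightarrow> f y < \<infinity> \<Longrightarrow> f (x + y) \<le> f x + f y"
  by (simp add: sublinear_def edom_def)

lemma sublinear_scaleR:
  "sublinear f \<Longrightarrow> f x < \<infinity> \<Longrightarrow> t \<ge> 0 \<Longrightarrow> f (t *\<^sub>R x) = ereal t * f x"
  by (simp add: sublinear_def edom_def)

lemma proper_ereal_cases:
  assumes "proper f"
  obtains "f x = \<infinity>" | r where "f x = ereal r"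
  using assms by (cases "f x") (auto simp: proper_def)

lemma proper_not_MInf: "proper f \<Longrightarrow> f x \<noteq> -\<infinity>"
  by (auto simp: proper_def)

text \<open>Properness excludes \<open>-\<infinity>\<close>, so a sum below
  \<open>\<infinity>\<close> has only real summands and the computation takes place in the
  reals.\<close>

lemma sublinear_sum:
  assumes "finite I" and f: "\<And>i. i \<in> I \<Longrightarrow> proper (f i)" "\<And>i. i \<in> I \<Longrightarrow> sublinear (f i)"
  shows "sublinear (\<lambda>x. \<Sum>i\<in>I. f i x)"
proof -
  have fin: "f i x < \<infinity>" if "(\<Sum>j\<in>I. f j x) < \<infinity>" "i \<in> I" for i x
    using that \<open>finite I\<close> by (auto simp: sum_Pinfty)
  have sum_eq: "(\<Sum>i\<in>I. f i x) = ereal (\<Sum>i\<in>I. real_of_ereal (f i x))"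
    if "(\<Sum>j\<in>I. f j x) < \<infinity>" for x
    unfolding sum_ereal[symmetric]
  proof (rule sum.cong[OF refl])
    fix i assume "i \<in> I"
    with fin[OF that this] proper_not_MInf[OF f(1)[OF this], of x]
    show "f i x = ereal (real_of_ereal (f i x))"
      by (cases "f i x") auto
  qed
  show ?thesis
    unfolding sublinear_def edom_def mem_Collect_eq
  proof (intro conjI ballI allI impI, goal_cases)
    case 1
    then show ?case using sublinear_zero[OF f(2)] by simp
  next
    case (2 x y)
    then show ?case
      using sublinear_add_le[OF f(2)] fin
      by (auto simp: sum.distrib[symmetric] intro!: sum_mono)
  next
    case (3 x t)
    then have x: "(\<Sum>j\<in>I. f j x) < \<infinity>" by simp
    have "(\<Sum>i\<in>I. f i (t *\<^sub>R x)) = (\<Sum>i\<in>I. ereal (t * real_of_ereal (f i x)))"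
    proof (rule sum.cong[OF refl])
      fix i assume i: "i \<in> I"
      with fin[OF x this] 3(2) proper_not_MInf[OF f(1)[OF this], of x]
        sublinear_scaleR[OF f(2)[OF this], of x t]
      show "f i (t *\<^sub>R x) = ereal (t * real_of_ereal (f i x))"
        by (cases "f i x") auto
    qed
    also have "\<dots> = ereal t * (\<Sum>i\<in>I. f i x)"
      by (simp add: sum_eq[OF x] sum_distrib_left)
    finally show ?case .
  qed
qed

lemma proper_sum:
  assumes "finite I" "\<And>i. i \<in> I \<Longrightarrow> proper (f i)" "\<And>i. i \<in> I \<Longrightarrow> sublinear (f i)"
  shows "proper (\<lambda>x. \<Sum>i\<in>I. f i x)"
proof -
  have "(\<Sum>i\<in>I. f i 0) = 0"
    using sublinear_zero[OF assms(3)] by simp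
  moreover have "(\<Sum>i\<in>I. f i x) \<noteq> -\<infinity>" for x
    using assms(1,2) by (induction I) (auto simp: proper_not_MInf)
  ultimately show ?thesis
    by (auto simp: proper_def edom_def intro!: exI[of _ 0])
qed

text \<open>The slack is fixed, while a violation at \<open>y\<close> grows linearly along the ray
  through \<open>y\<close>; so no violation is possible.\<close>

lemma eps_subdiff_zero:
  assumes "sublinear f" "\<epsilon> \<ge> 0" and p: "proper f"
  shows "eps_subdiff \<epsilon> f 0 = {\<phi>. \<forall>y. ereal (dual_apply \<phi> y) \<le> f y}"
proof (intro equalityI subsetI CollectI allI)
  fix \<phi> y assume "\<phi> \<in> eps_subdiff \<epsilon> f 0"
  then have \<phi>: "ereal (dual_apply \<phi> z) \<le> f z + ereal \<epsilon>" for z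
    by (simp add: eps_subdiff_def sublinear_zero[OF assms(1)])
  from p show "ereal (dual_apply \<phi> y) \<le> f y"
  proof (cases rule: proper_ereal_cases[of f y])
    case (2 r)
    have "dual_apply \<phi> y \<le> r"
    proof (rule ccontr)
      assume less: "\<not> dual_apply \<phi> y \<le> r"
      \<comment> \<open>At \<open>t *\<^sub>R y\<close> the violation is exactly
        \<open>\<epsilon> + 1\<close>.\<close>
      define t where "t = (\<epsilon> + 1) / (dual_apply \<phi> y - r)"
      have "t \<ge> 0" using less assms(2) by (simp add: t_def)
      then have "t * dual_apply \<phi> y \<le> t * r + \<epsilon>"
        using \<phi>[of "t *\<^sub>R y"] sublinear_scaleR[OF assms(1), of y t] 2
        by (simp add: linear_cmul[OF linear_dual_apply])
      moreover have "t * (dual_apply \<phi> y - r) = \<epsilon> + 1"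
        using less by (simp add: t_def)
      ultimately show False by (simp add: algebra_simps)
    qed
    with 2 show ?thesis by simp
  qed simp
next
  fix \<phi> assume "\<phi> \<in> {\<phi>. \<forall>y. ereal (dual_apply \<phi> y) \<le> f y}"
  then have "ereal (dual_apply \<phi> y) \<le> f y" for y by blast
  moreover have "f y \<le> f y + ereal \<epsilon>" for y
    using assms(2) by (cases "f y") auto
  ultimately show "\<phi> \<in> eps_subdiff \<epsilon> f 0"
    by (auto simp: eps_subdiff_def sublinear_zero[OF assms(1)] intro: order_trans)
qed

text \<open>Testing at 0 gives the inequality at \<open>x\<close>. Testing at \<open>z + x\<close>
  and using subadditivity moves the base point to the origin, where the slack disappears.\<close>

lemma eps_subdiff_sublinear:
  assumes f: "sublinear f" "proper f" and "\<epsilon> \<ge> 0"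
  shows "eps_subdiff \<epsilon> f x = {\<phi> \<in> subdiff f 0. f x \<le> ereal (dual_apply \<phi> x + \<epsilon>)}"
  using f(2)
proof (cases rule: proper_ereal_cases[of f x])
  case 1
  then show ?thesis by (simp add: eps_subdiff_def)
next
  case (2 r)
  show ?thesis
  proof (intro equalityI subsetI)
    fix \<phi> assume "\<phi> \<in> eps_subdiff \<epsilon> f x"
    then have \<phi>: "ereal (dual_apply \<phi> (y - x)) + ereal r \<le> f y + ereal \<epsilon>" for y
      by (simp add: eps_subdiff_def 2)
    have le: "r \<le> dual_apply \<phi> x + \<epsilon>"
      using \<phi>[of 0] by (simp add: sublinear_zero[OF f(1)] linear_neg[OF linear_dual_apply])
    have "ereal (dual_apply \<phi> z) \<le> f z + ereal \<epsilon>" for z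
    proof (cases "f z < \<infinity>")
      case True
      have "ereal (dual_apply \<phi> z) + ereal r \<le> f (z + x) + ereal \<epsilon>"
        using \<phi>[of "z + x"] by simp
      also have "\<dots> \<le> (f z + f x) + ereal \<epsilon>"
        by (intro add_right_mono sublinear_add_le f(1)) (use True 2 in auto)
      finally show ?thesis
        by (cases "f z") (auto simp: 2)
    qed auto
    then have "\<phi> \<in> eps_subdiff \<epsilon> f 0"
      by (simp add: eps_subdiff_def sublinear_zero[OF f(1)])
    with le show "\<phi> \<in> {\<phi> \<in> subdiff f 0. f x \<le> ereal (dual_apply \<phi> x + \<epsilon>)}"
      using f \<open>\<epsilon> \<ge> 0\<close> 2 by (simp add: eps_subdiff_zero)
  next
    fix \<phi> assume "\<phi> \<in> {\<phi> \<in> subdiff f 0. f x \<le> ereal (dual_apply \<phi> x + \<epsilon>)}"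
    then have le: "r \<le> dual_apply \<phi> x + \<epsilon>" and \<phi>: "\<And>y. ereal (dual_apply \<phi> y) \<le> f y"
      using f 2 by (auto simp: eps_subdiff_zero)
    have "ereal (dual_apply \<phi> (y - x)) + f x \<le> f y + ereal \<epsilon>" for y
      using \<phi>[of y] le 2 by (cases "f y") (auto simp: linear_diff[OF linear_dual_apply])
    then show "\<phi> \<in> eps_subdiff \<epsilon> f x"
      by (simp add: eps_subdiff_def 2)
  qed
qed

text \<open>On the subdifferential the supremum is attained at 0; off it, some ray carries a
  positive excess that scaling makes arbitrarily large.\<close>

lemma conjugate_sublinear:
  assumes f: "sublinear f" "proper f"
  shows "conjugate f \<phi> = (if \<phi> \<in> subdiff f 0 then 0 else \<infinity>)"
proof (cases "\<phi> \<in> subdiff f 0")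
  case True
  then have le: "ereal (dual_apply \<phi> x) \<le> f x" for x
    using f by (auto simp: eps_subdiff_zero)
  have "ereal (dual_apply \<phi> x) - f x \<le> 0" for x
    using le[of x] proper_not_MInf[OF f(2), of x] by (cases "f x") (auto simp: zero_ereal_def)
  moreover have "0 \<le> conjugate f \<phi>"
    unfolding conjugate_def
    by (rule SUP_upper2[of 0]) (auto simp: sublinear_zero[OF f(1)] linear_0[OF linear_dual_apply])
  ultimately show ?thesis
    using True by (auto simp: conjugate_def intro!: antisym SUP_least)
next
  case False
  then obtain x where x: "\<not> ereal (dual_apply \<phi> x) \<le> f x"
    using f by (auto simp: eps_subdiff_zero)
  then obtain r where r: "f x = ereal r" "r < dual_apply \<phi> x"
    using proper_not_MInf[OF f(2), of x] by (cases "f x") auto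
  have "ereal b \<le> conjugate f \<phi>" for b
  proof -
    define t where "t = \<bar>b\<bar> / (dual_apply \<phi> x - r)"
    have "t \<ge> 0" using r by (simp add: t_def)
    have "b \<le> t * (dual_apply \<phi> x - r)" using r by (simp add: t_def)
    then have "ereal b \<le> ereal (dual_apply \<phi> (t *\<^sub>R x)) - f (t *\<^sub>R x)"
      using sublinear_scaleR[OF f(1), of x t] \<open>t \<ge> 0\<close> r
      by (simp add: linear_cmul[OF linear_dual_apply] algebra_simps)
    also have "\<dots> \<le> conjugate f \<phi>"
      unfolding conjugate_def by (rule SUP_upper) simp
    finally show ?thesis .
  qed
  then have "conjugate f \<phi> = \<infinity>" by (rule ereal_top)
  with False show ?thesis by simp
qed

section \<open>The lower semicontinuous hull lies below the support function\<close>

lemma epi_sublinear_add: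
  assumes "sublinear f" "f x \<le> ereal r" "f y \<le> ereal s"
  shows "f (x + y) \<le> ereal (r + s)"
proof -
  have "f (x + y) \<le> f x + f y"
    using assms by (intro sublinear_add_le) auto
  also have "\<dots> \<le> ereal r + ereal s"
    using assms by (intro add_mono)
  finally show ?thesis by simp
qed

lemma epi_sublinear_scaleR:
  assumes "sublinear f" "f x \<le> ereal r" "t \<ge> 0"
  shows "f (t *\<^sub>R x) \<le> ereal (t * r)"
proof -
  have "f (t *\<^sub>R x) = ereal t * f x"
    using assms by (intro sublinear_scaleR) auto
  also have "\<dots> \<le> ereal t * ereal r"
    using assms by (intro ereal_mult_left_mono) auto
  finally show ?thesis by simp
qed

lemma convex_epi_sublinear: "sublinear f \<Longrightarrow> convex (epi f)"
  unfolding convex_def epi_def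
  by (auto intro!: epi_sublinear_add epi_sublinear_scaleR)

lemma lsc_hull_le: "lsc_hull f x \<le> f x"
  unfolding lsc_hull_def by (rule SUP_least) (auto simp: le_fun_def)

lemma lsc_hull_nhd:
  fixes f :: "'a::locally_convex_space \<Rightarrow> ereal"
  assumes "a < lsc_hull f x"
  obtains W where "open W" "0 \<in> W" "\<And>w. w \<in> W \<Longrightarrow> a < f (x + w)"
proof -
  obtain g where g: "lower_semicontinuous g" "g \<le> f" "a < g x"
    using assms unfolding lsc_hull_def less_SUP_iff by auto
  then have "\<forall>\<^sub>F y in nhds x. a < g y"
    by (simp add: lower_semicontinuous_def)
  then obtain T where T: "open T" "x \<in> T" "\<And>y. y \<in> T \<Longrightarrow> a < g y"
    unfolding eventually_nhds by blast
  show ?thesis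
  proof (rule that)
    show "open ((\<lambda>w. x + w) -` T)"
      by (intro open_vimage T(1) continuous_on_add continuous_on_const continuous_on_id)
    show "0 \<in> (\<lambda>w. x + w) -` T" using T(2) by simp
    show "a < f (x + w)" if "w \<in> (\<lambda>w. x + w) -` T" for w
      using T(3)[of "x + w"] g(2) that by (auto simp: le_fun_def intro: less_le_trans)
  qed
qed

text \<open>A point strictly below the hull has a product neighbourhood that misses the epigraph.
  Since the epigraph is a cone, a bound by \<open>L (x, a)\<close> on it improves to a bound by 0.
  The case \<open>\<beta> = 0\<close> is a vertical hyperplane.\<close>

lemma epi_separation:
  fixes f :: "'a::locally_convex_space \<Rightarrow> ereal"
  assumes f: "sublinear f" and a: "ereal a < lsc_hull f x"
  obtains l \<beta> where "linear l" "continuous_on UNIV l" "\<beta> \<ge> 0"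
    "\<And>y r. f y \<le> ereal r \<Longrightarrow> l y \<le> \<beta> * r" "\<beta> * a < l x"
proof -
  \<comment> \<open>The level \<open>b\<close> between \<open>a\<close> and the hull leaves vertical
    room \<open>b - a\<close> for the neighbourhood.\<close>
  obtain b where b: "a < b" "ereal b < lsc_hull f x"
    using ereal_dense2[OF a] by auto
  obtain V where V: "open V" "0 \<in> V" "\<And>w. w \<in> V \<Longrightarrow> ereal b < f (x + w)"
    using lsc_hull_nhd[OF b(2)] by metis
  obtain W where W: "open W" "convex W" "0 \<in> W" "W \<subseteq> V" "\<And>w. w \<in> W \<Longrightarrow> - w \<in> W"
    using symmetric_convex_nhd[OF V(1,2)] by metis
  define d where "d = b - a"
  have d: "d > 0" using b(1) by (simp add: d_def)
  define U where "U = W \<times> {-d<..<d}"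
  have U: "convex U"
    unfolding U_def by (intro convex_Times W(2) convex_real_interval)
  have absorb: "\<exists>t>0. t *\<^sub>R v \<in> U" for v
  proof -
    obtain y r where v: "v = (y, r)" by (cases v)
    obtain s where s: "s > 0" "\<And>t. 0 \<le> t \<Longrightarrow> t \<le> s \<Longrightarrow> t *\<^sub>R y \<in> W"
      using open_absorbing[OF W(1,3)] by metis
    define t where "t = min s (d / (\<bar>r\<bar> + 1))"
    have t: "t > 0" using s(1) d by (simp add: t_def)
    have "t * \<bar>r\<bar> < t * (\<bar>r\<bar> + 1)" using t by simp
    also have "\<dots> \<le> d"
      using mult_right_mono[of t "d / (\<bar>r\<bar> + 1)" "\<bar>r\<bar> + 1"] by (simp add: t_def)
    finally have "\<bar>t * r\<bar> < d" using t by (simp add: abs_mult)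
    then have "t *\<^sub>R v \<in> U"
      using s(2)[of t] t by (auto simp: U_def v t_def)
    with t show ?thesis by blast
  qed
  have zero: "(0, r) \<in> epi f" if "r \<ge> 0" for r
    using that sublinear_zero[OF f] by (simp add: epi_def)
  have "(x, a) \<noteq> c + u" if c: "c \<in> epi f" and u: "u \<in> U" for c u
  proof
    assume eq: "(x, a) = c + u"
    obtain w r where ur: "u = (w, r)" "w \<in> W" "\<bar>r\<bar> < d"
      using u by (auto simp: U_def)
    \<comment> \<open>Symmetry of \<open>W\<close> gives \<open>f (x - w) > b\<close>, whereas
      \<open>\<bar>r\<bar> < d\<close> gives \<open>a - r < b\<close>.\<close>
    have "c = (x + - w, a - r)"
      using eq unfolding ur(1) by (metis add_diff_cancel_right' diff_Pair diff_conv_add_uminus)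
    with c have "f (x + - w) \<le> ereal (a - r)" by (simp add: epi_def)
    moreover have "ereal b < f (x + - w)"
      using V(3)[of "- w"] W(4,5) ur(2) by blast
    ultimately have "ereal b < ereal (a - r)" by (rule less_le_trans[rotated])
    then show False using ur(3) by (simp add: d_def)
  qed
  with convex_absorbing_separation[OF U absorb convex_epi_sublinear[OF f]]
  obtain L :: "'a \<times> real \<Rightarrow> real" where L: "linear L"
    "\<And>c u. c \<in> epi f \<Longrightarrow> u \<in> U \<Longrightarrow> L c + L u \<le> L (x, a)" "\<exists>u\<in>U. L u > 0"
    using zero[of 0] by (metis empty_iff order_refl)
  define l where "l y = L (y, 0)" for y
  define \<beta> where "\<beta> = - L (0, 1)"
  have L_eq: "L (y, r) = l y - \<beta> * r" for y r
    using linear_add[OF L(1), of "(y, 0)" "r *\<^sub>R (0, 1)"] linear_cmul[OF L(1), of r "(0, 1)"]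
    by (simp add: l_def \<beta>_def)
  have zero_U: "0 \<in> U" using W(3) d by (simp add: U_def zero_prod_def)
  have nonpos: "L c \<le> 0" if c: "c \<in> epi f" for c
  proof (rule ccontr)
    assume pos: "\<not> L c \<le> 0"
    \<comment> \<open>The multiple \<open>t *\<^sub>R c\<close> stays in the cone, but
      \<open>L\<close> takes the value \<open>\<bar>L (x, a)\<bar> + 1\<close> there.\<close>
    define t where "t = (\<bar>L (x, a)\<bar> + 1) / L c"
    have "t \<ge> 0" using pos by (simp add: t_def)
    then have "t *\<^sub>R c \<in> epi f"
      using c epi_sublinear_scaleR[OF f] by (auto simp: epi_def)
    from L(2)[OF this zero_U] pos show False
      by (simp add: linear_cmul[OF L(1)] linear_0[OF L(1)] t_def)
  qed
  have l: "linear l"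
    using linear_add[OF L(1), of "(_, 0)" "(_, 0)"] linear_cmul[OF L(1), of _ "(_, 0)"]
    by (intro linearI) (simp_all add: l_def)
  show ?thesis
  proof (rule that)
    show "linear l" by (fact l)
    have "l w \<le> L (x, a)" if "w \<in> W" for w
      using L(2)[OF zero[of 0], of "(w, 0)"] that d linear_0[OF L(1)]
      by (simp add: l_def U_def zero_prod_def)
    from linear_continuous_of_bounded[OF l W(1,3,5) this] show "continuous_on UNIV l" .
    show "\<beta> \<ge> 0" using nonpos[OF zero[of 1]] by (simp add: \<beta>_def)
    show "l y \<le> \<beta> * r" if "f y \<le> ereal r" for y r
      using nonpos[of "(y, r)"] that by (simp add: epi_def L_eq)
    \<comment> \<open>As \<open>(0, 0)\<close> lies in the epigraph, \<open>L (x, a)\<close> is at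
      least \<open>L u\<close>; this is where strictness comes from.\<close>
    obtain u where "u \<in> U" "L u > 0" using L(3) by blast
    then have "L (x, a) > 0"
      using L(2)[OF zero[of 0], of u] linear_0[OF L(1)] by (simp add: zero_prod_def)
    then show "\<beta> * a < l x" by (simp add: L_eq)
  qed
qed

lemma subdiff_zero_if_normalized:
  fixes f :: "'a::locally_convex_space \<Rightarrow> ereal"
  assumes f: "sublinear f" "proper f" and l: "linear l" "continuous_on UNIV l"
    and \<beta>: "\<beta> > 0" "\<And>y r. f y \<le> ereal r \<Longrightarrow> l y \<le> \<beta> * r"
  shows "inverse \<beta> *\<^sub>R Dual l \<in> subdiff f 0"
proof -
  have "ereal (dual_apply (inverse \<beta> *\<^sub>R Dual l) y) \<le> f y" for y
    using f(2)
  proof (cases rule: proper_ereal_cases[of f y])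
    case (2 r)
    then show ?thesis
      using \<beta>(2)[of y r] \<beta>(1) by (simp add: dual_apply_Dual[OF l] field_simps)
  qed simp
  then show ?thesis using f by (simp add: eps_subdiff_zero)
qed

text \<open>
  A vertical separating hyperplane only bounds the domain of \<open>f\<close>; it is tilted by adding a large
  multiple of it to a subgradient at the origin, which exists because \<open>lsc_hull f 0\<close> is not
  \<open>-\<infinity>\<close>.
\<close>

lemma lsc_hull_le_support:
  fixes f :: "'a::locally_convex_space \<Rightarrow> ereal"
  assumes f: "sublinear f" "proper f" and zero: "lsc_hull f 0 \<noteq> -\<infinity>"
    and a: "ereal a < lsc_hull f x"
  obtains \<phi> where "\<phi> \<in> subdiff f 0" "a < dual_apply \<phi> x"
proof -
  obtain c where "ereal c < lsc_hull f 0"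
    using zero ereal_dense2[of "-\<infinity>" "lsc_hull f 0"] by auto
  from epi_separation[OF f(1) this]
  obtain l\<^sub>0 \<beta>\<^sub>0 where l0: "linear l\<^sub>0" "continuous_on UNIV l\<^sub>0" "\<beta>\<^sub>0 \<ge> 0"
    "\<And>y r. f y \<le> ereal r \<Longrightarrow> l\<^sub>0 y \<le> \<beta>\<^sub>0 * r" "\<beta>\<^sub>0 * c < l\<^sub>0 0"
    by metis
  \<comment> \<open>At the origin the strict inequality reads
    \<open>\<beta>\<^sub>0 * c < 0\<close>, which a vertical hyperplane violates.\<close>
  from l0(5) have "\<beta>\<^sub>0 \<noteq> 0" by (auto simp: linear_0[OF l0(1)])
  with l0(3) have "\<beta>\<^sub>0 > 0" by simp
  define \<phi>\<^sub>0 where "\<phi>\<^sub>0 = inverse \<beta>\<^sub>0 *\<^sub>R Dual l\<^sub>0"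
  have \<phi>\<^sub>0: "\<phi>\<^sub>0 \<in> subdiff f 0"
    unfolding \<phi>\<^sub>0_def by (rule subdiff_zero_if_normalized[OF f l0(1,2) \<open>\<beta>\<^sub>0 > 0\<close> l0(4)])
  from epi_separation[OF f(1) a]
  obtain l \<beta> where l: "linear l" "continuous_on UNIV l" "\<beta> \<ge> 0"
    "\<And>y r. f y \<le> ereal r \<Longrightarrow> l y \<le> \<beta> * r" "\<beta> * a < l x"
    by metis
  show ?thesis
  proof (cases "\<beta> = 0")
    case False
    with l(3) have "\<beta> > 0" by simp
    show ?thesis
    proof (rule that)
      show "inverse \<beta> *\<^sub>R Dual l \<in> subdiff f 0"
        by (rule subdiff_zero_if_normalized[OF f l(1,2) \<open>\<beta> > 0\<close> l(4)])
      show "a < dual_apply (inverse \<beta> *\<^sub>R Dual l) x"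
        using l(5) \<open>\<beta> > 0\<close> by (simp add: dual_apply_Dual[OF l(1,2)] field_simps)
    qed
  next
    case True
    \<comment> \<open>Then \<open>dual_apply \<phi>\<^sub>0 x + t * l x\<close> exceeds
      \<open>a\<close>. The added multiple of \<open>l\<close> is harmless, since for
      \<open>\<beta> = 0\<close> the functional \<open>l\<close> is nonpositive on the domain of
      \<open>f\<close>.\<close>
    define t where "t = (\<bar>a - dual_apply \<phi>\<^sub>0 x\<bar> + 1) / l x"
    have lx: "l x > 0" using l(5) True by simp
    then have t: "t \<ge> 0" "t * l x = \<bar>a - dual_apply \<phi>\<^sub>0 x\<bar> + 1" by (auto simp: t_def)
    show ?thesis
    proof (rule that)
      have "ereal (dual_apply (\<phi>\<^sub>0 + t *\<^sub>R Dual l) y) \<le> f y" for y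
        using f(2)
      proof (cases rule: proper_ereal_cases[of f y])
        case (2 r)
        have "t * l y \<le> 0"
          using l(4)[of y r] 2 True t(1) by (simp add: mult_nonneg_nonpos)
        moreover have "ereal (dual_apply \<phi>\<^sub>0 y) \<le> f y"
          using \<phi>\<^sub>0 f by (auto simp: eps_subdiff_zero)
        ultimately show ?thesis
          using 2 by (simp add: dual_apply_Dual[OF l(1,2)])
      qed simp
      then show "\<phi>\<^sub>0 + t *\<^sub>R Dual l \<in> subdiff f 0"
        using f by (simp add: eps_subdiff_zero)
      show "a < dual_apply (\<phi>\<^sub>0 + t *\<^sub>R Dual l) x"
        using t(2) by (simp add: dual_apply_Dual[OF l(1,2)])
    qed
  qed
qed

section \<open>Finite families\<close>

lemma mem_set_sum_iff:
  "finite I \<Longrightarrow> z \<in> (\<Sum>i\<in>I. A i) \<longleftrightarrow> (\<exists>s. (\<forall>i\<in>I. s i \<in> A i) \<and> z = (\<Sum>i\<in>I. s i))"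
  by (auto simp: set_sum_alt)

lemma convex_set_sum_family:
  assumes "finite I" "\<And>i. i \<in> I \<Longrightarrow> convex (A i)"
  shows "convex (\<Sum>i\<in>I. A i)"
  using assms by (induction I) (auto intro: convex_set_plus)

lemma convex_subdiff_zero:
  assumes "sublinear f" "proper f"
  shows "convex (subdiff f 0)"
proof -
  have le_iff: "ereal r \<le> f y \<longleftrightarrow> (f y < \<infinity> \<longrightarrow> r \<le> real_of_ereal (f y))" for r y
    using proper_not_MInf[OF assms(2), of y] by (cases "f y") auto
  have "subdiff f 0 = (\<Inter>y\<in>edom f. (\<lambda>\<phi>. dual_apply \<phi> y) -` {..real_of_ereal (f y)})"
    using assms by (auto simp: eps_subdiff_zero edom_def le_iff)
  then show ?thesis
    by (auto intro!: convex_INT convex_linear_vimage linear_dual_apply_left)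
qed

lemma closed_subdiff_zero:
  assumes "sublinear f" "proper f"
  shows "closed (subdiff f 0)"
proof -
  have "closed {\<phi>. ereal (dual_apply \<phi> y) \<le> f y}" for y
    by (cases "f y")
      (auto intro!: closed_Collect_le continuous_on_dual_apply continuous_on_const)
  then have "closed (\<Inter>y. {\<phi>. ereal (dual_apply \<phi> y) \<le> f y})"
    by blast
  also have "(\<Inter>y. {\<phi>. ereal (dual_apply \<phi> y) \<le> f y}) = subdiff f 0"
    using assms by (auto simp: eps_subdiff_zero)
  finally show ?thesis .
qed

section \<open>Indicator functions, their infimal convolution and their epigraphs\<close>

lemma lower_semicontinuous_indicator_iff:
  "lower_semicontinuous (\<lambda>z. if z \<in> S then 0 else \<infinity>) \<longleftrightarrow> closed S"
proof
  assume lsc: "lower_semicontinuous (\<lambda>z. if z \<in> S then 0 else \<infinity>)"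
  have "\<exists>T. open T \<and> x \<in> T \<and> T \<subseteq> - S" if "x \<in> - S" for x
  proof -
    have "\<forall>\<^sub>F y in nhds x. 0 < (if y \<in> S then 0 else \<infinity> :: ereal)"
      using lsc that unfolding lower_semicontinuous_def by (elim allE[of _ x] allE[of _ 0]) auto
    then show ?thesis
      unfolding eventually_nhds by (metis ComplI less_irrefl subsetI)
  qed
  then show "closed S"
    unfolding closed_def by (subst open_subopen) blast
next
  assume "closed S"
  show "lower_semicontinuous (\<lambda>z. if z \<in> S then 0 else \<infinity>)"
    unfolding lower_semicontinuous_def
  proof (intro allI impI)
    fix x and a :: ereal assume a: "a < (if x \<in> S then 0 else \<infinity>)"
    show "\<forall>\<^sub>F y in nhds x. a < (if y \<in> S then 0 else \<infinity>)"
    proof (cases "x \<in> S")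
      case True
      with a show ?thesis by (intro always_eventually) auto
    next
      case False
      then have "\<forall>\<^sub>F y in nhds x. y \<in> - S"
        using \<open>closed S\<close> by (intro eventually_nhds_in_open) auto
      then show ?thesis
        by (rule eventually_mono) (use a False in auto)
    qed
  qed
qed

lemma closed_Times_atLeast_iff:
  fixes S :: "'a::topological_space set" and c :: real
  shows "closed (S \<times> {c..}) \<longleftrightarrow> closed S"
proof
  assume "closed (S \<times> {c..})"
  then have "closed ((\<lambda>z. (z, c)) -` (S \<times> {c..}))"
    by (rule closed_vimage) (intro continuous_on_Pair continuous_on_id continuous_on_const)
  also have "(\<lambda>z. (z, c)) -` (S \<times> {c..}) = S" by auto
  finally show "closed S" .
qed (simp add: closed_Times)

text \<open>A decomposition costs 0 if every piece lies in its set and \<open>\<infinity>\<close>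
  otherwise, so any admissible decomposition attains the infimum. This is why exactness comes for
  free in (vii).\<close>

lemma inf_conv_indicator:
  assumes "finite I" and h: "\<And>i z. i \<in> I \<Longrightarrow> h i z = (if z \<in> A i then 0 else \<infinity>)"
  shows "inf_conv I h z = (if z \<in> (\<Sum>i\<in>I. A i) then 0 else \<infinity>)"
    and "z \<in> (\<Sum>i\<in>I. A i) \<Longrightarrow> inf_conv_exact_at I h z"
proof -
  have sum_h: "(\<Sum>i\<in>I. h i (w i)) = (if \<forall>i\<in>I. w i \<in> A i then 0 else \<infinity>)" for w
  proof (cases "\<forall>i\<in>I. w i \<in> A i")
    case False
    then show ?thesis using \<open>finite I\<close> by (auto simp: sum_Pinfty h)
  qed (simp add: h)
  show eq: "inf_conv I h z = (if z \<in> (\<Sum>i\<in>I. A i) then 0 else \<infinity>)" for z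
  proof (cases "z \<in> (\<Sum>i\<in>I. A i)")
    case True
    then obtain s where "\<forall>i\<in>I. s i \<in> A i" "z = (\<Sum>i\<in>I. s i)"
      using \<open>finite I\<close> by (auto simp: mem_set_sum_iff)
    then have "inf_conv I h z \<le> 0"
      unfolding inf_conv_def using sum_h[of s] by (intro Inf_lower) (auto intro!: exI[of _ s])
    moreover have "0 \<le> inf_conv I h z"
      unfolding inf_conv_def by (rule Inf_greatest) (auto simp: sum_h)
    ultimately show ?thesis using True by simp
  next
    case False
    have "\<infinity> \<le> inf_conv I h z"
      unfolding inf_conv_def
    proof (rule Inf_greatest, safe)
      fix w assume "z = (\<Sum>i\<in>I. w i)"
      with False \<open>finite I\<close> have "\<not> (\<forall>i\<in>I. w i \<in> A i)"
        by (auto simp: mem_set_sum_iff)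
      then show "\<infinity> \<le> (\<Sum>i\<in>I. h i (w i))" unfolding sum_h by simp
    qed
    with False show ?thesis by simp
  qed
  assume z: "z \<in> (\<Sum>i\<in>I. A i)"
  then obtain s where "\<forall>i\<in>I. s i \<in> A i" "z = (\<Sum>i\<in>I. s i)"
    using \<open>finite I\<close> by (auto simp: mem_set_sum_iff)
  with z show "inf_conv_exact_at I h z"
    unfolding inf_conv_exact_at_def by (intro exI[of _ s]) (simp add: eq sum_h)
qed

text \<open>For empty \<open>I\<close> the left side would be the single point
  \<open>(0, 0)\<close>; otherwise the height can be shared out evenly.\<close>

lemma sum_Times_atLeast_zero:
  fixes A :: "'i \<Rightarrow> 'b::comm_monoid_add set"
  assumes "finite I" "I \<noteq> {}"
  shows "(\<Sum>i\<in>I. A i \<times> {0::real..}) = (\<Sum>i\<in>I. A i) \<times> {0..}"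
proof (intro equalityI subsetI)
  fix p assume "p \<in> (\<Sum>i\<in>I. A i \<times> {0::real..})"
  then obtain s where s: "\<forall>i\<in>I. s i \<in> A i \<times> {0..}" "p = (\<Sum>i\<in>I. s i)"
    using assms(1) by (auto simp: mem_set_sum_iff)
  then have "fst p \<in> (\<Sum>i\<in>I. A i)"
    using assms(1) by (auto simp: mem_set_sum_iff fst_sum mem_Times_iff intro!: exI[of _ "\<lambda>i. fst (s i)"])
  moreover have "snd p \<ge> 0"
    using s by (auto simp: snd_sum mem_Times_iff intro!: sum_nonneg)
  ultimately show "p \<in> (\<Sum>i\<in>I. A i) \<times> {0..}"
    by (simp add: mem_Times_iff)
next
  fix p assume "p \<in> (\<Sum>i\<in>I. A i) \<times> {0::real..}"
  then obtain s where s: "\<forall>i\<in>I. s i \<in> A i" "fst p = (\<Sum>i\<in>I. s i)" "snd p \<ge> 0"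
    using assms(1) by (auto simp: mem_set_sum_iff)
  define q where "q i = (s i, snd p / card I)" for i
  have "p = (\<Sum>i\<in>I. q i)"
    using s(2) assms by (simp add: prod_eq_iff fst_sum snd_sum q_def)
  moreover have "\<forall>i\<in>I. q i \<in> A i \<times> {0..}"
    using s by (simp add: q_def)
  ultimately show "p \<in> (\<Sum>i\<in>I. A i \<times> {0::real..})"
    using assms(1) by (auto simp: mem_set_sum_iff)
qed

section \<open>The sum function: redistribution of slack and the closure inclusion\<close>

context
  fixes I :: "'i set" and f :: "'i \<Rightarrow> 'a::locally_convex_space \<Rightarrow> ereal"
  assumes finite_I: "finite I"
    and proper: "\<And>i. i \<in> I \<Longrightarrow> proper (f i)"
    and sublinear: "\<And>i. i \<in> I \<Longrightarrow> sublinear (f i)"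
begin

text \<open>The defining inequalities are added up. Zero slack gives the easy inclusion in (viii),
  and constant slack gives the total from which the constant in (i) arises.\<close>

lemma sum_eps_subdiff_subset:
  assumes e: "\<And>i. i \<in> I \<Longrightarrow> e i \<ge> 0"
  shows "(\<Sum>i\<in>I. eps_subdiff (e i) (f i) x) \<subseteq> eps_subdiff (\<Sum>i\<in>I. e i) (\<lambda>x. \<Sum>i\<in>I. f i x) x"
proof
  fix \<phi> assume "\<phi> \<in> (\<Sum>i\<in>I. eps_subdiff (e i) (f i) x)"
  then obtain s where s: "\<And>i. i \<in> I \<Longrightarrow> s i \<in> eps_subdiff (e i) (f i) x" "\<phi> = (\<Sum>i\<in>I. s i)"
    using finite_I by (auto simp: mem_set_sum_iff)
  have le: "ereal (dual_apply (s i) y) \<le> f i y" and le_x: "f i x \<le> ereal (dual_apply (s i) x + e i)"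
    if "i \<in> I" for i y
    using s(1)[OF that] e[OF that] proper[OF that] sublinear[OF that]
    by (auto simp: eps_subdiff_sublinear[of _ "e i"] eps_subdiff_zero)
  have "ereal (dual_apply \<phi> y) \<le> (\<Sum>i\<in>I. f i y)" for y
    using le by (auto simp: s(2) sum_ereal[symmetric] simp del: sum_ereal intro!: sum_mono)
  moreover have "(\<Sum>i\<in>I. f i x) \<le> ereal (dual_apply \<phi> x + (\<Sum>i\<in>I. e i))"
    using sum_mono[OF le_x] by (simp add: s(2) sum.distrib)
  moreover note sublinear_sum[OF finite_I proper sublinear] proper_sum[OF finite_I proper sublinear]
  ultimately show "\<phi> \<in> eps_subdiff (\<Sum>i\<in>I. e i) (\<lambda>x. \<Sum>i\<in>I. f i x) x"
    using e by (simp add: eps_subdiff_sublinear[of _ "\<Sum>i\<in>I. e i"] eps_subdiff_zero sum_nonneg)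
qed

text \<open>
  Every \<open>f i x - dual_apply (s i) x\<close> is nonnegative, so these gaps serve as the \<open>e i\<close> once the
  remaining slack is shared out evenly.
\<close>

lemma eps_subdiff_sum_split:
  assumes "I \<noteq> {}" and \<phi>: "\<phi> \<in> (\<Sum>i\<in>I. subdiff (f i) 0)"
    and le: "(\<Sum>i\<in>I. f i x) \<le> ereal (dual_apply \<phi> x + \<epsilon>)"
  obtains e where "\<And>i. i \<in> I \<Longrightarrow> e i \<ge> 0" "(\<Sum>i\<in>I. e i) = \<epsilon>"
    "\<phi> \<in> (\<Sum>i\<in>I. eps_subdiff (e i) (f i) x)"
proof -
  obtain s where s: "\<And>i. i \<in> I \<Longrightarrow> s i \<in> subdiff (f i) 0" "\<phi> = (\<Sum>i\<in>I. s i)"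
    using finite_I \<phi> by (auto simp: mem_set_sum_iff)
  have "(\<Sum>i\<in>I. f i x) \<noteq> \<infinity>" using le by auto
  then have "f i x \<noteq> \<infinity>" if "i \<in> I" for i
    using that finite_I by (auto simp: sum_Pinfty)
  then have fx: "f i x = ereal (real_of_ereal (f i x))" if "i \<in> I" for i
    using that proper_not_MInf[OF proper[OF that], of x] by (cases "f i x") auto
  define g where "g i = real_of_ereal (f i x) - dual_apply (s i) x" for i
  have g: "g i \<ge> 0" if "i \<in> I" for i
  proof -
    have "ereal (dual_apply (s i) x) \<le> f i x"
      using s(1)[OF that] proper[OF that] sublinear[OF that] by (auto simp: eps_subdiff_zero)
    with fx[OF that] show ?thesis by (simp add: g_def) (metis ereal_less_eq(3))
  qed
  have "(\<Sum>i\<in>I. f i x) = ereal (\<Sum>i\<in>I. real_of_ereal (f i x))"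
    unfolding sum_ereal[symmetric] by (rule sum.cong[OF refl fx])
  with le have sum_g: "(\<Sum>i\<in>I. g i) \<le> \<epsilon>"
    by (simp add: g_def s(2) sum_subtractf)
  define e where "e i = g i + (\<epsilon> - (\<Sum>i\<in>I. g i)) / card I" for i
  have e: "e i \<ge> g i" for i using sum_g by (simp add: e_def)
  show ?thesis
  proof (rule that)
    show nonneg: "e i \<ge> 0" if "i \<in> I" for i using g[OF that] e[of i] by simp
    show "(\<Sum>i\<in>I. e i) = \<epsilon>"
      using assms(1) finite_I by (simp add: e_def sum.distrib)
    have "s i \<in> eps_subdiff (e i) (f i) x" if "i \<in> I" for i
    proof -
      have "f i x \<le> ereal (dual_apply (s i) x + e i)"
        by (subst fx[OF that]) (use e[of i] in \<open>simp add: g_def\<close>)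
      then show ?thesis
        using s(1)[OF that] eps_subdiff_sublinear[OF sublinear[OF that] proper[OF that] nonneg[OF that]]
        by simp
    qed
    then show "\<phi> \<in> (\<Sum>i\<in>I. eps_subdiff (e i) (f i) x)"
      using finite_I s(2) by (auto simp: mem_set_sum_iff)
  qed
qed

lemma subdiff_sum_zero_subset_closure:
  assumes hull: "\<And>i x. i \<in> I \<Longrightarrow> x \<in> (\<Inter>j\<in>I. edom (lsc_hull (f j))) \<Longrightarrow> lsc_hull (f i) x = f i x"
  shows "subdiff (\<lambda>x. \<Sum>i\<in>I. f i x) 0 \<subseteq> closure (\<Sum>i\<in>I. subdiff (f i) 0)"
proof (rule subsetI, rule ccontr)
  let ?S = "\<Sum>i\<in>I. subdiff (f i) 0"
  fix \<phi> assume \<phi>: "\<phi> \<in> subdiff (\<lambda>x. \<Sum>i\<in>I. f i x) 0" and notin: "\<phi> \<notin> closure ?S"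
  have "0 \<in> (\<Inter>j\<in>I. edom (lsc_hull (f j)))"
  proof
    fix j assume "j \<in> I"
    then show "0 \<in> edom (lsc_hull (f j))"
      using lsc_hull_le[of "f j" 0] sublinear_zero[OF sublinear] by (auto simp: edom_def)
  qed
  then have hull_zero: "lsc_hull (f i) 0 = 0" if "i \<in> I" for i
    using hull[OF that] sublinear_zero[OF sublinear[OF that]] by simp
  have support: "\<exists>\<psi>\<in>subdiff (f i) 0. a < dual_apply \<psi> x" if "i \<in> I" "ereal a < lsc_hull (f i) x" for i a x
    using lsc_hull_le_support[OF sublinear[OF that(1)] proper[OF that(1)] _ that(2)] hull_zero[OF that(1)]
    by (metis MInfty_neq_ereal(2) zero_ereal_def)
  \<comment> \<open>The level -1 lies below the hull value 0 at the origin. The functionals obtained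
    here fill the other positions when a single index is varied.\<close>
  have "\<forall>i\<in>I. \<exists>\<psi>. \<psi> \<in> subdiff (f i) 0"
    using support[of _ "-1" 0] hull_zero by fastforce
  then obtain p where p: "\<And>i. i \<in> I \<Longrightarrow> p i \<in> subdiff (f i) 0" by metis
  have "convex ?S"
    using finite_I proper sublinear by (intro convex_set_sum_family convex_subdiff_zero) auto
  moreover have "?S \<noteq> {}"
    using p finite_I by (auto simp: set_sum_alt)
  ultimately obtain x b where b: "\<And>\<psi>. \<psi> \<in> ?S \<Longrightarrow> dual_apply \<psi> x \<le> b" "b < dual_apply \<phi> x"
    using weak_star_separation[OF _ _ notin] by metis
  have le_b: "(\<Sum>i\<in>I. dual_apply (s i) x) \<le> b" if "\<And>i. i \<in> I \<Longrightarrow> s i \<in> subdiff (f i) 0" for s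
    using b(1)[of "\<Sum>i\<in>I. s i"] that finite_I by (auto simp: mem_set_sum_iff)
  have "x \<in> (\<Inter>j\<in>I. edom (lsc_hull (f j)))"
  proof
    fix j assume j: "j \<in> I"
    \<comment> \<open>What the bound \<open>b\<close> leaves for index \<open>j\<close> when all
      other summands are held at \<open>p\<close>.\<close>
    define c where "c = b - (\<Sum>i\<in>I - {j}. dual_apply (p i) x)"
    have "lsc_hull (f j) x \<le> ereal c"
    proof (rule ccontr)
      assume "\<not> lsc_hull (f j) x \<le> ereal c"
      then obtain \<psi> where \<psi>: "\<psi> \<in> subdiff (f j) 0" "c < dual_apply \<psi> x"
        using support[OF j, of c x] by (meson not_le)
      have "(\<Sum>i\<in>I. dual_apply ((p(j := \<psi>)) i) x) \<le> b"
        by (rule le_b) (use p \<psi>(1) in auto)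
      with \<psi>(2) show False
        by (simp add: c_def sum.remove[OF finite_I j])
    qed
    then show "x \<in> edom (lsc_hull (f j))"
      by (auto simp: edom_def)
  qed
  then have hull_x: "lsc_hull (f i) x = f i x" "f i x < \<infinity>" if "i \<in> I" for i
    using hull[OF that, of x] that by (auto simp: edom_def)
  have fx: "f i x = ereal (real_of_ereal (f i x))" if "i \<in> I" for i
    using hull_x(2)[OF that] proper_not_MInf[OF proper[OF that], of x] by (cases "f i x") auto
  \<comment> \<open>Approximating every summand within \<open>\<delta>\<close> loses
    \<open>card I * \<delta>\<close> in total; the added 1 keeps this strictly below the separation
    gap.\<close>
  define \<delta> where "\<delta> = (dual_apply \<phi> x - b) / (card I + 1)"
  have \<delta>: "\<delta> > 0" using b(2) by (simp add: \<delta>_def)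
  have "\<exists>\<psi>\<in>subdiff (f i) 0. real_of_ereal (f i x) - \<delta> < dual_apply \<psi> x" if i: "i \<in> I" for i
  proof (rule support[OF i])
    show "ereal (real_of_ereal (f i x) - \<delta>) < lsc_hull (f i) x"
      unfolding hull_x(1)[OF i] by (subst (2) fx[OF i]) (use \<delta> in simp)
  qed
  then obtain s where s: "\<And>i. i \<in> I \<Longrightarrow> s i \<in> subdiff (f i) 0"
    "\<And>i. i \<in> I \<Longrightarrow> real_of_ereal (f i x) - \<delta> < dual_apply (s i) x"
    by metis
  have "(\<Sum>i\<in>I. real_of_ereal (f i x)) - card I * \<delta> = (\<Sum>i\<in>I. real_of_ereal (f i x) - \<delta>)"
    by (simp add: sum_subtractf)
  also have "\<dots> \<le> (\<Sum>i\<in>I. dual_apply (s i) x)"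
    using s(2) by (intro sum_mono) (simp add: less_imp_le)
  also have "\<dots> \<le> b" by (rule le_b[OF s(1)])
  finally have "(\<Sum>i\<in>I. real_of_ereal (f i x)) \<le> b + card I * \<delta>" by simp
  also have "\<dots> < b + (card I + 1) * \<delta>"
    using \<delta> by (simp add: algebra_simps)
  also have "\<dots> = dual_apply \<phi> x" by (simp add: \<delta>_def)
  finally have "(\<Sum>i\<in>I. real_of_ereal (f i x)) < dual_apply \<phi> x" .
  moreover have "ereal (dual_apply \<phi> x) \<le> (\<Sum>i\<in>I. f i x)"
    using \<phi> sublinear_sum[OF finite_I proper sublinear] proper_sum[OF finite_I proper sublinear]
    by (simp add: eps_subdiff_zero)
  moreover have "(\<Sum>i\<in>I. f i x) = ereal (\<Sum>i\<in>I. real_of_ereal (f i x))"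
    unfolding sum_ereal[symmetric] by (rule sum.cong[OF refl fx])
  ultimately show False by simp
qed

end

section \<open>Assembling the eight conditions\<close>

lemma eps_subdiff_mono:
  "\<delta> \<le> \<epsilon> \<Longrightarrow> eps_subdiff \<delta> f x \<subseteq> eps_subdiff \<epsilon> f x"
  unfolding eps_subdiff_def by (auto intro: order_trans[OF _ add_left_mono])

lemma set_sum_mono_family:
  fixes A B :: "'i \<Rightarrow> 'b::comm_monoid_add set"
  shows "(\<And>i. i \<in> I \<Longrightarrow> A i \<subseteq> B i) \<Longrightarrow> (\<Sum>i\<in>I. A i) \<subseteq> (\<Sum>i\<in>I. B i)"
  by (induction I rule: infinite_finite_induct) (simp_all add: set_plus_mono2)

theorem corollary3p14:
  fixes m :: nat
    and f :: "nat \<Rightarrow> 'a::locally_convex_space \<Rightarrow> ereal"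
  assumes "m \<ge> 1"
    and "\<And>i. i \<in> {1..m} \<Longrightarrow> proper (f i)"
    and "\<And>i. i \<in> {1..m} \<Longrightarrow> sublinear (f i)"
    and "\<And>i x. i \<in> {1..m} \<Longrightarrow> x \<in> (\<Inter>j\<in>{1..m}. edom (lsc_hull (f j))) \<Longrightarrow> lsc_hull (f i) x = f i x"
  shows "all_equivalent
    [ \<comment> \<open>(i)\<close>
      \<exists>K>0. \<forall>x \<in> (\<Inter>i\<in>{1..m}. edom (f i)). \<forall>\<epsilon>>0.
        closure (\<Sum>i\<in>{1..m}. eps_subdiff \<epsilon> (f i) x) \<subseteq> (\<Sum>i\<in>{1..m}. eps_subdiff (K * \<epsilon>) (f i) x),
      \<comment> \<open>(ii)\<close>
      closed (\<Sum>i\<in>{1..m}. subdiff (f i) 0),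
      \<comment> \<open>(iii)\<close>
      conjugate (\<lambda>x. \<Sum>i\<in>{1..m}. f i x) = inf_conv {1..m} (\<lambda>i. conjugate (f i)),
      \<comment> \<open>(iv)\<close>
      lower_semicontinuous (inf_conv {1..m} (\<lambda>i. conjugate (f i))),
      \<comment> \<open>(v)\<close>
      \<forall>x. \<forall>\<epsilon>\<ge>0. eps_subdiff \<epsilon> (\<lambda>x. \<Sum>i\<in>{1..m}. f i x) x =
        (\<Inter>\<eta>\<in>{0<..}. \<Union>e\<in>{e. (\<forall>i\<in>{1..m}. e i \<ge> 0) \<and> (\<Sum>i\<in>{1..m}. e i) = \<epsilon> + \<eta>}.
          \<Sum>i\<in>{1..m}. eps_subdiff (e i) (f i) x),
      \<comment> \<open>(vi)\<close>
      closed (\<Sum>i\<in>{1..m}. epi (conjugate (f i))),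
      \<comment> \<open>(vii)\<close>
      conjugate (\<lambda>x. \<Sum>i\<in>{1..m}. f i x) = inf_conv {1..m} (\<lambda>i. conjugate (f i)) \<and>
        (\<forall>z. \<bar>inf_conv {1..m} (\<lambda>i. conjugate (f i)) z\<bar> \<noteq> \<infinity> \<longrightarrow>
          inf_conv_exact_at {1..m} (\<lambda>i. conjugate (f i)) z),
      \<comment> \<open>(viii)\<close>
      \<forall>x. subdiff (\<lambda>x. \<Sum>i\<in>{1..m}. f i x) x = (\<Sum>i\<in>{1..m}. subdiff (f i) x) ]"
  (is "all_equivalent [?i, ?ii, ?iii, ?iv, ?v, ?vi, ?vii, ?viii]")
proof -
  let ?I = "{1..m}"
  let ?F = "\<lambda>x. \<Sum>i\<in>?I. f i x"
  let ?S = "\<Sum>i\<in>?I. subdiff (f i) 0"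
  let ?A = "subdiff ?F 0"
  have I: "finite ?I" "?I \<noteq> {}" using assms(1) by auto
  note pf = assms(2) and sf = assms(3)
  have F: "sublinear ?F" "proper ?F"
    using sublinear_sum[OF I(1) pf sf] proper_sum[OF I(1) pf sf] by auto
  note sum_subset = sum_eps_subdiff_subset[where f = f, OF I(1) pf sf]
  \<comment> \<open>At the origin slack changes nothing, so (i) and (v) can be read there as
    statements about \<open>?S\<close>.\<close>
  have zero: "(\<Sum>i\<in>?I. eps_subdiff (e i) (f i) 0) = ?S" if "\<forall>i\<in>?I. e i \<ge> 0" for e
    by (rule sum.cong[OF refl]) (use that pf sf in \<open>auto simp: eps_subdiff_zero\<close>)
  have sub: "?S \<subseteq> ?A"
    using sum_subset[where e = "\<lambda>_. 0" and x = 0] by simp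
  have split: "\<exists>e. (\<forall>i\<in>?I. e i \<ge> 0) \<and> (\<Sum>i\<in>?I. e i) = \<epsilon> \<and> \<phi> \<in> (\<Sum>i\<in>?I. eps_subdiff (e i) (f i) x)"
    if "\<phi> \<in> ?S" "?F x \<le> ereal (dual_apply \<phi> x + \<epsilon>)" for \<phi> x \<epsilon>
    using eps_subdiff_sum_split[OF I(1) pf sf I(2) that] by metis
  have conj_f: "conjugate (f i) \<phi> = (if \<phi> \<in> subdiff (f i) 0 then 0 else \<infinity>)" if "i \<in> ?I" for i \<phi>
    using conjugate_sublinear[OF sf[OF that] pf[OF that]] .
  have conj_F: "conjugate ?F = (\<lambda>\<phi>. if \<phi> \<in> ?A then 0 else \<infinity>)"
    using conjugate_sublinear[OF F] by blast
  have conv: "inf_conv ?I (\<lambda>i. conjugate (f i)) = (\<lambda>\<phi>. if \<phi> \<in> ?S then 0 else \<infinity>)"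
    by (rule ext) (rule inf_conv_indicator(1)[OF I(1) conj_f])
  have epi_f: "epi (conjugate (f i)) = subdiff (f i) 0 \<times> {0..}" if "i \<in> ?I" for i
    using conj_f[OF that] by (auto simp: epi_def split: if_splits)
  \<comment> \<open>The only place where the hull hypothesis enters; the other conditions are
    compared directly with one of these two.\<close>
  have closed_iff: "?ii \<longleftrightarrow> ?A = ?S"
  proof
    assume "closed ?S"
    with subdiff_sum_zero_subset_closure[where f = f, OF I(1) pf sf assms(4)] sub show "?A = ?S"
      by (simp add: closure_closed)
  next
    assume "?A = ?S"
    then show "closed ?S" using closed_subdiff_zero[OF F] by simp
  qed
  have iii: "?iii \<longleftrightarrow> ?A = ?S"
  proof
    assume "?iii"
    then have "(if \<phi> \<in> ?A then 0 else \<infinity> :: ereal) = (if \<phi> \<in> ?S then 0 else \<infinity>)" for \<phi>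
      unfolding conj_F conv by (rule fun_cong)
    then show "?A = ?S" by (metis PInfty_neq_ereal(1) zero_ereal_def set_eqI)
  next
    assume "?A = ?S"
    then show "?iii" unfolding conj_F conv by simp
  qed
  have vii: "?vii \<longleftrightarrow> ?A = ?S"
  proof -
    have "inf_conv_exact_at ?I (\<lambda>i. conjugate (f i)) z"
      if "\<bar>inf_conv ?I (\<lambda>i. conjugate (f i)) z\<bar> \<noteq> \<infinity>" for z
    proof (rule inf_conv_indicator(2)[OF I(1) conj_f])
      show "z \<in> ?S" using that unfolding conv by (auto split: if_splits)
    qed
    with iii show ?thesis by blast
  qed
  have iv: "?iv \<longleftrightarrow> ?ii"
    unfolding conv by (rule lower_semicontinuous_indicator_iff)
  have "(\<Sum>i\<in>?I. epi (conjugate (f i))) = (\<Sum>i\<in>?I. subdiff (f i) 0 \<times> {0..})"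
    by (rule sum.cong[OF refl epi_f])
  also have "\<dots> = ?S \<times> {0..}"
    by (rule sum_Times_atLeast_zero[OF I])
  finally have vi: "?vi \<longleftrightarrow> ?ii"
    using closed_Times_atLeast_iff by (rule ssubst)
  have i: "?i \<longleftrightarrow> ?ii"
  proof
    assume ?i
    then obtain K where K: "K > 0" "\<forall>x \<in> (\<Inter>i\<in>?I. edom (f i)). \<forall>\<epsilon>>0.
        closure (\<Sum>i\<in>?I. eps_subdiff \<epsilon> (f i) x) \<subseteq> (\<Sum>i\<in>?I. eps_subdiff (K * \<epsilon>) (f i) x)"
      by blast
    have "0 \<in> (\<Inter>i\<in>?I. edom (f i))"
      using sublinear_zero[OF sf] by (auto simp: edom_def)
    \<comment> \<open>At the origin the sums for slack 1 and for slack \<open>K\<close> are both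
      \<open>?S\<close>.\<close>
    from K(2)[rule_format, OF this, of 1] have "closure ?S \<subseteq> ?S"
      using K(1) zero[of "\<lambda>_. 1"] zero[of "\<lambda>_. K * 1"] by simp
    then show ?ii
      by (metis closed_closure closure_subset subset_antisym)
  next
    assume closed: ?ii
    show ?i
    \<comment> \<open>A sum of \<open>m\<close> functionals with slack \<open>\<epsilon>\<close>
      each has total slack \<open>m * \<epsilon>\<close>, and redistribution may assign all of it to
      one index.\<close>
    proof (intro exI[of _ "real m"] conjI ballI allI impI subsetI)
      show "real m > 0" using assms(1) by simp
      fix x \<epsilon> \<phi>
      assume x: "x \<in> (\<Inter>i\<in>?I. edom (f i))" and \<epsilon>: "\<epsilon> > (0::real)"
        and \<phi>: "\<phi> \<in> closure (\<Sum>i\<in>?I. eps_subdiff \<epsilon> (f i) x)"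
      \<comment> \<open>A limit point inherits no decomposition with prescribed slacks, but it
        inherits membership in the closed sets \<open>?S\<close> and \<open>?T\<close>, from which a
        decomposition with total slack \<open>m * \<epsilon>\<close> is rebuilt.\<close>
      let ?T = "{\<phi>. ?F x \<le> ereal (dual_apply \<phi> x + m * \<epsilon>)}"
      have "closed ?T"
      proof (cases "?F x")
        case (real r)
        then show ?thesis
          by (auto intro!: closed_Collect_le continuous_on_add continuous_on_dual_apply continuous_on_const)
      qed auto
      moreover have "(\<Sum>i\<in>?I. eps_subdiff \<epsilon> (f i) x) \<subseteq> eps_subdiff (m * \<epsilon>) ?F x"
        using sum_subset[where e = "\<lambda>_. \<epsilon>" and x = x] \<epsilon> by simp
      then have "(\<Sum>i\<in>?I. eps_subdiff \<epsilon> (f i) x) \<subseteq> ?T"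
        using eps_subdiff_sublinear[OF F, of "m * \<epsilon>" x] \<epsilon> by auto
      moreover have "eps_subdiff \<epsilon> (f i) x \<subseteq> subdiff (f i) 0" if "i \<in> ?I" for i
        using eps_subdiff_sublinear[OF sf[OF that] pf[OF that], of \<epsilon> x] \<epsilon> by auto
      then have "(\<Sum>i\<in>?I. eps_subdiff \<epsilon> (f i) x) \<subseteq> ?S"
        by (rule set_sum_mono_family)
      ultimately have "\<phi> \<in> ?S" "\<phi> \<in> ?T"
        using \<phi> closed closure_minimal by blast+
      then obtain e where e: "\<forall>i\<in>?I. e i \<ge> 0" "(\<Sum>i\<in>?I. e i) = m * \<epsilon>"
        "\<phi> \<in> (\<Sum>i\<in>?I. eps_subdiff (e i) (f i) x)"
        using split by blast
      have "e i \<le> m * \<epsilon>" if "i \<in> ?I" for i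
        using member_le_sum[OF that, of e] e(1,2) by simp
      then have "(\<Sum>i\<in>?I. eps_subdiff (e i) (f i) x) \<subseteq> (\<Sum>i\<in>?I. eps_subdiff (m * \<epsilon>) (f i) x)"
        by (intro set_sum_mono_family eps_subdiff_mono)
      with e(3) show "\<phi> \<in> (\<Sum>i\<in>?I. eps_subdiff (m * \<epsilon>) (f i) x)" by blast
    qed
  qed
  have v: "?v \<longleftrightarrow> ?A = ?S"
  proof
    assume ?v
    then have "?A = (\<Inter>\<eta>\<in>{0<..}. \<Union>e\<in>{e. (\<forall>i\<in>?I. e i \<ge> 0) \<and> (\<Sum>i\<in>?I. e i) = 0 + \<eta>}.
          \<Sum>i\<in>?I. eps_subdiff (e i) (f i) 0)"
      by blast
    \<comment> \<open>One value of \<open>\<eta>\<close> suffices, since at the origin every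
      admissible \<open>e\<close> gives \<open>?S\<close>.\<close>
    also have "\<dots> \<subseteq> (\<Union>e\<in>{e. (\<forall>i\<in>?I. e i \<ge> 0) \<and> (\<Sum>i\<in>?I. e i) = 0 + 1}.
          \<Sum>i\<in>?I. eps_subdiff (e i) (f i) 0)"
      by (rule INT_lower) simp
    also have "\<dots> \<subseteq> ?S"
    proof (rule UN_least)
      fix e :: "nat \<Rightarrow> real" assume "e \<in> {e. (\<forall>i\<in>?I. e i \<ge> 0) \<and> (\<Sum>i\<in>?I. e i) = 0 + 1}"
      then have "\<forall>i\<in>?I. e i \<ge> 0" by blast
      from zero[OF this] show "(\<Sum>i\<in>?I. eps_subdiff (e i) (f i) 0) \<subseteq> ?S"
        by (rule equalityD1)
    qed
    finally show "?A = ?S" using sub by blast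
  next
    assume eq: "?A = ?S"
    show ?v
    proof (intro allI impI equalityI subsetI INT_I)
      fix x \<epsilon> \<phi> \<eta>
      assume "\<epsilon> \<ge> (0::real)" "\<phi> \<in> eps_subdiff \<epsilon> ?F x" "\<eta> \<in> {0::real<..}"
      \<comment> \<open>The slack is enlarged to \<open>\<epsilon> + \<eta>\<close> first, because
        redistribution returns slacks whose sum is exactly the given total.\<close>
      then have "\<phi> \<in> eps_subdiff (\<epsilon> + \<eta>) ?F x" "\<epsilon> + \<eta> \<ge> 0"
        using eps_subdiff_mono[of \<epsilon> "\<epsilon> + \<eta>" ?F x] by auto
      then have "\<phi> \<in> ?S" "?F x \<le> ereal (dual_apply \<phi> x + (\<epsilon> + \<eta>))"
        using eps_subdiff_sublinear[OF F, of "\<epsilon> + \<eta>" x] eq by auto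
      from split[OF this]
      show "\<phi> \<in> (\<Union>e\<in>{e. (\<forall>i\<in>?I. e i \<ge> 0) \<and> (\<Sum>i\<in>?I. e i) = \<epsilon> + \<eta>}.
          \<Sum>i\<in>?I. eps_subdiff (e i) (f i) x)"
        by blast
    next
      fix x \<epsilon> \<phi>
      assume \<epsilon>: "\<epsilon> \<ge> (0::real)"
        and \<phi>: "\<phi> \<in> (\<Inter>\<eta>\<in>{0<..}. \<Union>e\<in>{e. (\<forall>i\<in>?I. e i \<ge> 0) \<and> (\<Sum>i\<in>?I. e i) = \<epsilon> + \<eta>}.
          \<Sum>i\<in>?I. eps_subdiff (e i) (f i) x)"
      have mem: "\<phi> \<in> eps_subdiff (\<epsilon> + \<eta>) ?F x" if "\<eta> > 0" for \<eta>
      proof -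
        obtain e where e: "\<forall>i\<in>?I. e i \<ge> 0" "(\<Sum>i\<in>?I. e i) = \<epsilon> + \<eta>"
          "\<phi> \<in> (\<Sum>i\<in>?I. eps_subdiff (e i) (f i) x)"
          using \<phi> \<open>\<eta> > 0\<close> by blast
        have "(\<Sum>i\<in>?I. eps_subdiff (e i) (f i) x) \<subseteq> eps_subdiff (\<epsilon> + \<eta>) ?F x"
          using sum_subset[where e = e and x = x] e(1,2) by simp
        with e(3) show ?thesis by blast
      qed
      have "\<phi> \<in> ?A" and le: "?F x \<le> ereal (dual_apply \<phi> x + \<epsilon> + \<eta>)" if "\<eta> > 0" for \<eta>
        using mem[OF that] eps_subdiff_sublinear[OF F, of "\<epsilon> + \<eta>" x] \<epsilon> that
        by (auto simp: add.assoc)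
      then have "\<phi> \<in> ?A" using zero_less_one by blast
      moreover have "?F x \<le> ereal (dual_apply \<phi> x + \<epsilon>)"
        by (rule ereal_le_epsilon2) (use le in simp)
      ultimately show "\<phi> \<in> eps_subdiff \<epsilon> ?F x"
        using eps_subdiff_sublinear[OF F \<epsilon>] by auto
    qed
  qed
  have viii: "?viii \<longleftrightarrow> ?A = ?S"
  proof
    assume eq: "?A = ?S"
    show ?viii
    proof (intro allI equalityI subsetI)
      fix x \<phi> assume "\<phi> \<in> subdiff ?F x"
      then have "\<phi> \<in> ?S" "?F x \<le> ereal (dual_apply \<phi> x + 0)"
        using eps_subdiff_sublinear[OF F order_refl, of x] eq by auto
      from split[OF this] obtain e where e: "\<forall>i\<in>?I. e i \<ge> 0" "(\<Sum>i\<in>?I. e i) = 0"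
        "\<phi> \<in> (\<Sum>i\<in>?I. eps_subdiff (e i) (f i) x)"
        by blast
      \<comment> \<open>Nonnegative slacks with total 0 all vanish.\<close>
      have "e i = 0" if "i \<in> ?I" for i
        using sum_nonneg_eq_0_iff[OF I(1), of e] e(1,2) that by blast
      then have "(\<Sum>i\<in>?I. eps_subdiff (e i) (f i) x) = (\<Sum>i\<in>?I. subdiff (f i) x)"
        by (intro sum.cong) auto
      with e(3) show "\<phi> \<in> (\<Sum>i\<in>?I. subdiff (f i) x)" by simp
    next
      fix x \<phi> assume "\<phi> \<in> (\<Sum>i\<in>?I. subdiff (f i) x)"
      then show "\<phi> \<in> subdiff ?F x" using sum_subset[where e = "\<lambda>_. 0" and x = x] by auto
    qed
  \<comment> \<open>The remaining direction is the instance of (viii) at the origin.\<close>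
  qed blast
  from closed_iff iii iv i v vi vii viii show ?thesis
    unfolding all_equivalent_def by simp
qed

end
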